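(* For every integer $d\ge 1$ let $a_d=\dfrac{d^{d/2}}{2^{d-1}}$. (i) There are real numbers $r_k(d)$ ($k\ge 1$) such that for every $m\ge 0$, as $n\to\infty$, $$x_n^{(d)}=a_d\frac{d^{2n}}{(\pi n)^{(d-1)/2}}\left(1+\frac{r_1(d)}{n}+\frac{r_2(d)}{n^2}+\dots+\frac{r_m(d)}{n^m}+O_{d,m}\left(\frac1{n^{m+1}}\right)\right),$$ where $r_1(d)=\frac{1-d}{8}$, $r_2(d)=\frac{(d^2-1)(2d-3)}{384}$, and $r_3(d)$, $r_4(d)$ are polynomials in $d$ of degree $4$ and $6$, namely $r_3(d)=\frac1{3072}(d-1)(6d^3-19d^2+14d+15)$, $r_4(d)=\frac{1}{1474560}(d-1)(20d^5+2504d^4-10241d^3+9679d^2+309d+945)$. (ii) There are real numbers $a_k(d)$ ($k\ge 1$) such that for every $m\ge 0$, as $n\to\infty$, $$A_{2n}^{(d)}=a_d\frac{(2d)^{2n}}{(\pi n)^{d/2}}\left(1+\frac{a_1(d)}{n}+\frac{a_2(d)}{n^2}+\dots+\frac{a_m(d)}{n^m}+O_{d,m}\left(\frac1{n^{m+1}}\right)\right),$$ where $a_1(d)=-\frac d8$, $a_2(d)=\frac{2d^3-3d^2+4d}{384}$, and $a_3(d)$, $a_4(d)$ are polynomials in $d$ of degree $4$ and $6$, namely $a_3(d)=\frac{1}{1024}d^2(2d^2-9d+12)$, $a_4(d)=\frac1{1474560}d(20d^5+2484d^4-13105d^3+21480d^2-11440d-384)$.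
   Context: $A_{2n}^{(d)}$ is the number of closed walks of length $2n$ in $\mathbb Z^d$: sequences of $2n$ steps, each one of $\pm e_1,\dots,\pm e_d$, starting and ending at the origin ($A_0^{(d)}=1$). $x_n^{(d)}=A_{2n}^{(d)}/\binom{2n}{n}$, so $x_0^{(d)}=1$. $O_{d,m}$ means the implied constant depends only on $d$ and $m$. *)

theory Defs
  imports
    Complex_Main
    "HOL-Library.Landau_Symbols"
    "HOL-Computational_Algebra.Polynomial"
begin

text \<open>
  Since the dimension \<open>d\<close> is a variable, vectors of \<open>\<int>\<^sup>d\<close> are represented by functions
  \<open>nat \<Rightarrow> int\<close> that vanish outside the coordinates \<open>0, \<dots>, d - 1\<close>.
\<close>

definition unit_steps :: "nat \<Rightarrow> (nat \<Rightarrow> int) set" where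
  "unit_steps d = {(\<lambda>j. if j = i then s else 0) | i s. i < d \<and> s \<in> {1, -1}}"

text \<open>
  A walk from the origin is given by its list of steps; it is closed iff the steps sum to zero
  in every coordinate.
\<close>

definition closed_walks :: "nat \<Rightarrow> nat \<Rightarrow> (nat \<Rightarrow> int) list set" where
  "closed_walks d l =
     {w. length w = l \<and> set w \<subseteq> unit_steps d \<and> (\<forall>j<d. (\<Sum>s\<leftarrow>w. s j) = 0)}"

definition num_closed_walks :: "nat \<Rightarrow> nat \<Rightarrow> nat" where
  "num_closed_walks d l = card (closed_walks d l)"

definition walk_ratio :: "nat \<Rightarrow> nat \<Rightarrow> real" where
  "walk_ratio d n = real (num_closed_walks d (2 * n)) / real ((2 * n) choose n)"

definition lead_const :: "nat \<Rightarrow> real" where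
  "lead_const d = real d powr (real d / 2) / 2 ^ (d - 1)"

end

theory Submission
  imports Defs "HOL-Analysis.Analysis"
begin

text \<open>
  The idea is to describe the number \<open>A\<^sub>N\<close> of closed walks of length \<open>N\<close> first by a factorial series
  instead of a power series. With \<open>\<phi>\<^sub>c\<^sub>,\<^sub>s(N) = c\<^bsup>N+s\<^esup> / \<Gamma>(N + 1 + s)\<close> it turns out that for even \<open>N\<close>
  \<open>A\<^sub>N / N! ~ 2 \<Sum>\<^sub>k B\<^sub>k(d) \<phi>(N)\<close>, the \<open>k\<close>-th term having \<open>c = 2d\<close> and \<open>s = d/2 + k\<close>, and that the
  coefficients of dimension \<open>d\<close> are those of the \<open>d\<close>-th power of one explicit formal power series
  (\<open>walks_egf_expands\<close>). Formally \<open>\<phi>\<^sub>c\<^sub>,\<^sub>s\<close> are the coefficients of \<open>t\<^bsup>-s\<^esup> e\<^bsup>ct\<^esup>\<close>, so this is the large-\<open>t\<close>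
  expansion of \<open>I\<^sub>0(2t)\<^sup>d\<close>, the exponential generating function of the walks, carried over to
  coefficients.

  Three facts give that expansion. Choosing which steps use the last coordinate shows that the
  numbers \<open>A\<^sub>N / N!\<close> of dimension \<open>d + 1\<close> are the convolution of those of dimensions \<open>d\<close> and \<open>1\<close>
  (\<open>num_closed_walks_Suc_fact\<close>). The sequences \<open>\<phi>\<close> are closed under convolution up to an
  exponentially small error: by the Beta integral \<open>\<phi>\<^sub>a\<^sub>,\<^sub>s\<close> and \<open>\<phi>\<^sub>b\<^sub>,\<^sub>t\<close> convolve to \<open>\<phi>\<^sub>a\<^sub>+\<^sub>b\<^sub>,\<^sub>s\<^sub>+\<^sub>t\<close>
  (\<open>phi_convolution_asymp\<close>), and error terms convolve to error terms because everything is
  positive. For \<open>d = 1\<close> the central binomial coefficient is a moment of the arcsine law, and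
  expanding its density at the end of the support gives the coefficients
  (\<open>line_walks_egf_expands\<close>).

  It remains to rewrite the factorial series as a power series in \<open>1/n\<close>. Sequences with a full
  asymptotic expansion in \<open>1/n\<close> form a ring on which expansions multiply and invert like formal power
  series (\<open>expands_mult\<close>, \<open>expands_inverse\<close>, \<open>expands_factorial_series\<close>). After the leading
  factor is split off, the series has rational functions of \<open>n\<close> as terms, and the leading factor is
  the Gamma quotient \<open>\<Gamma>(2n + 1) / \<Gamma>(2n + 1 + d/2)\<close>. The latter is reduced by the functional equation to
  \<open>d = 0\<close> and \<open>d = 1\<close>; the case \<open>d = 1\<close> is Wallis' quotient, whose expansion comes from
  Gauss' evaluation of a hypergeometric series. The first four coefficients are then a computation
  with truncated formal power series whose coefficients are polynomials in \<open>d\<close>.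
\<close>

unbundle no vec_syntax
unbundle fps_syntax

section \<open>Asymptotic expansions in powers of 1/n\<close>

definition psum :: "real fps \<Rightarrow> nat \<Rightarrow> nat \<Rightarrow> real" where
  "psum F m n = (\<Sum>k\<le>m. F $ k / real n ^ k)"

definition expands :: "(nat \<Rightarrow> real) \<Rightarrow> real fps \<Rightarrow> bool" where
  "expands f F \<longleftrightarrow> (\<forall>m. (\<lambda>n. f n - psum F m n) \<in> O(\<lambda>n. 1 / real n ^ Suc m))"

lemma inverse_power_bigo_mono:
  assumes "m \<le> k"
  shows "(\<lambda>n. 1 / real n ^ k) \<in> O(\<lambda>n. 1 / real n ^ m)"
proof (rule bigoI[where c = 1])
  show "\<forall>\<^sub>F n in sequentially. norm (1 / real n ^ k) \<le> 1 * norm (1 / real n ^ m)"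
    using eventually_gt_at_top[of 0]
    by eventually_elim (auto simp: field_simps assms power_increasing)
qed

lemma inverse_power_term_bigo:
  assumes "m \<le> k"
  shows "(\<lambda>n. c / real n ^ k) \<in> O(\<lambda>n. 1 / real n ^ m)"
  using landau_o.big_mult[OF bigo_const[of c] inverse_power_bigo_mono[OF assms]] by simp

lemma psum_bigo_1: "psum F m \<in> O(\<lambda>_. 1)"
  unfolding psum_def
  by (rule big_sum_in_bigo) (use inverse_power_term_bigo[of 0] in auto)

lemma psum_tendsto: "psum F m \<longlonglongrightarrow> F $ 0"
proof -
  have "(\<lambda>n. \<Sum>k\<le>m. F $ k / real n ^ k) \<longlonglongrightarrow> (\<Sum>k\<le>m. if k = 0 then F $ 0 else 0)"
  proof (rule tendsto_sum)
    fix k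
    show "(\<lambda>n. F $ k / real n ^ k) \<longlonglongrightarrow> (if k = 0 then F $ 0 else 0)"
    proof (cases "k = 0")
      case False
      have "filterlim (\<lambda>n. real n ^ k) at_top sequentially"
        using False filterlim_pow_at_top[OF _ filterlim_real_sequentially] by simp
      from tendsto_divide_0[OF tendsto_const filterlim_at_top_imp_at_infinity[OF this]] False
      show ?thesis by simp
    qed simp
  qed
  then show ?thesis
    by (simp add: psum_def[abs_def])
qed

lemma psum_diff_bigo:
  assumes "m \<le> M"
  shows "(\<lambda>n. psum F M n - psum F m n) \<in> O(\<lambda>n. 1 / real n ^ Suc m)"
proof -
  have "psum F M n - psum F m n = (\<Sum>k\<in>{m<..M}. F $ k / real n ^ k)" for n
  proof -
    have "{..M} = {..m} \<union> {m<..M}" using assms by auto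
    then have "psum F M n = psum F m n + (\<Sum>k\<in>{m<..M}. F $ k / real n ^ k)"
      unfolding psum_def by (simp add: sum.union_disjoint ivl_disj_int)
    then show ?thesis by simp
  qed
  moreover have "(\<lambda>n. \<Sum>k\<in>{m<..M}. F $ k / real n ^ k) \<in> O(\<lambda>n. 1 / real n ^ Suc m)"
    by (rule big_sum_in_bigo) (use inverse_power_term_bigo[of "Suc m"] in auto)
  ultimately show ?thesis by simp
qed

lemma expands_bigo:
  assumes "expands f F"
  shows "(\<lambda>n. f n - psum F m n) \<in> O(\<lambda>n. 1 / real n ^ Suc m)"
  using assms by (auto simp: expands_def)

text \<open>
  This is how an expansion of an auxiliary sequence yields an error bound: error bounds below are
  obtained by showing that the formal series of the error has no low-order terms.
\<close>

lemma expands_bigo_vanishing: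
  assumes "expands f F" "\<And>k. k \<le> m \<Longrightarrow> F $ k = 0"
  shows "f \<in> O(\<lambda>n. 1 / real n ^ Suc m)"
  using expands_bigo[OF assms(1), of m] assms(2) by (simp add: psum_def)

lemma expands_bigo_1: 
  assumes "expands f F"
  shows "f \<in> O(\<lambda>_. 1)"
proof -
  have "(\<lambda>n. f n - psum F 0 n) \<in> O(\<lambda>_. 1)"
    using landau_o.big_trans[OF expands_bigo[OF assms, of 0] inverse_power_bigo_mono[of 0]] by simp
  from sum_in_bigo(1)[OF this psum_bigo_1[of F 0]] show ?thesis by simp
qed

lemma expands_tendsto:
  assumes "expands f F"
  shows "f \<longlonglongrightarrow> F $ 0"
proof -
  have "(\<lambda>n. 1 / real n) \<in> o(\<lambda>_. 1)"
    by (intro smalloI_tendsto) (auto intro: lim_1_over_n)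
  with expands_bigo[OF assms, of 0] have "(\<lambda>n. f n - psum F 0 n) \<in> o(\<lambda>_. 1)"
    using landau_o.big_small_trans by simp
  then have "(\<lambda>n. f n - psum F 0 n) \<longlonglongrightarrow> 0"
    using smalloD_tendsto by fastforce
  from tendsto_add[OF this psum_tendsto[of F 0]] show ?thesis by simp
qed

lemma expands_cong:
  assumes "expands f F" "\<forall>\<^sub>F n in sequentially. f n = g n"
  shows "expands g F"
  unfolding expands_def
proof
  fix m
  have "\<forall>\<^sub>F n in sequentially. f n - psum F m n = g n - psum F m n"
    using assms(2) by eventually_elim simp
  from landau_o.big.in_cong[OF this] expands_bigo[OF assms(1), of m]
  show "(\<lambda>n. g n - psum F m n) \<in> O(\<lambda>n. 1 / real n ^ Suc m)" by simp
qed

lemma expands_diff: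
  assumes "expands f F" "expands g G"
  shows "expands (\<lambda>n. f n - g n) (F - G)"
  unfolding expands_def
proof
  fix m
  have "(f n - psum F m n) - (g n - psum G m n) = f n - g n - psum (F - G) m n" for n
    by (simp add: psum_def sum_subtractf diff_divide_distrib)
  with sum_in_bigo(2)[OF assms[THEN expands_bigo, of m]]
  show "(\<lambda>n. f n - g n - psum (F - G) m n) \<in> O(\<lambda>n. 1 / real n ^ Suc m)" by simp
qed

lemma psum_mult_bigo:
  "(\<lambda>n. psum F m n * psum G m n - psum (F * G) m n) \<in> O(\<lambda>n. 1 / real n ^ Suc m)"
proof -
  define t where "t n = (\<lambda>(i, j). F $ i * G $ j / real n ^ (i + j))" for n
  let ?S = "{..m} \<times> {..m}" and ?T = "{(i, j). i + j \<le> m}"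
  have sub: "?T \<subseteq> ?S" by auto
  have "psum F m n * psum G m n - psum (F * G) m n = sum (t n) (?S - ?T)" for n
  proof -
    have "psum F m n * psum G m n = sum (t n) ?S"
      unfolding psum_def t_def
      by (simp add: sum_product sum.cartesian_product power_add)
    moreover have "psum (F * G) m n = (\<Sum>k\<le>m. \<Sum>i\<le>k. F $ i * G $ (k - i) / real n ^ (i + (k - i)))"
      unfolding psum_def fps_mult_nth atLeast0AtMost by (simp add: sum_divide_distrib)
    moreover have "\<dots> = sum (t n) ?T"
      unfolding t_def by (rule sum.triangle_reindex_eq[symmetric])
    ultimately show ?thesis using sub by (simp add: sum_diff)
  qed
  moreover have "(\<lambda>n. sum (t n) (?S - ?T)) \<in> O(\<lambda>n. 1 / real n ^ Suc m)"
    by (rule big_sum_in_bigo) (auto simp: t_def simp del: power_Suc intro!: inverse_power_term_bigo)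
  ultimately show ?thesis by simp
qed

lemma expands_mult:
  assumes "expands f F" "expands g G"
  shows "expands (\<lambda>n. f n * g n) (F * G)"
  unfolding expands_def
proof
  fix m
  let ?e = "\<lambda>n. 1 / real n ^ Suc m"
  have "(\<lambda>n. (f n - psum F m n) * g n) \<in> O(?e)"
    using landau_o.big_mult[OF expands_bigo[OF assms(1), of m] expands_bigo_1[OF assms(2)]] by simp
  moreover have "(\<lambda>n. psum F m n * (g n - psum G m n)) \<in> O(?e)"
    using landau_o.big_mult[OF psum_bigo_1 expands_bigo[OF assms(2), of m]] by simp
  ultimately have "(\<lambda>n. (f n - psum F m n) * g n + psum F m n * (g n - psum G m n) +
      (psum F m n * psum G m n - psum (F * G) m n)) \<in> O(?e)"
    by (intro sum_in_bigo(1) psum_mult_bigo)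
  then show "(\<lambda>n. f n * g n - psum (F * G) m n) \<in> O(?e)"
    by (simp add: algebra_simps)
qed

lemma expands_psum: "expands (psum F m) (Abs_fps (\<lambda>k. if k \<le> m then F $ k else 0))"
  (is "expands _ ?C")
  unfolding expands_def
proof
  fix M
  have *: "psum F m n = psum ?C m n" for n by (simp add: psum_def)
  show "(\<lambda>n. psum F m n - psum ?C M n) \<in> O(\<lambda>n. 1 / real n ^ Suc M)"
  proof (cases "M \<le> m")
    case True
    from psum_diff_bigo[OF this, of ?C] show ?thesis by (simp only: *)
  next
    case False
    then have "{..m} \<subseteq> {..M}" by auto
    then have "psum ?C M n = psum ?C m n" for n
      unfolding psum_def by (intro sum.mono_neutral_right) auto
    then show ?thesis by (simp add: *)
  qed
qed

lemma expands_const: "expands (\<lambda>_. c) (fps_const c)"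
  and expands_one_plus: "expands (\<lambda>n. 1 + c / real n) (1 + fps_const c * fps_X)"
proof -
  have "(\<lambda>n. c) = psum (fps_const c) 0" by (auto simp: psum_def)
  moreover have "Abs_fps (\<lambda>k. if k \<le> 0 then fps_const c $ k else 0) = fps_const c"
    by (auto simp: fps_eq_iff)
  ultimately show "expands (\<lambda>_. c) (fps_const c)"
    using expands_psum[of "fps_const c" 0] by simp
  let ?F = "1 + fps_const c * fps_X"
  have "(\<lambda>n. 1 + c / real n) = psum ?F 1" by (auto simp: psum_def)
  moreover have "Abs_fps (\<lambda>k. if k \<le> 1 then ?F $ k else 0) = ?F"
    by (auto simp: fps_eq_iff fps_X_def)
  ultimately show "expands (\<lambda>n. 1 + c / real n) ?F"
    using expands_psum[of ?F 1] by simp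
qed

text \<open>
  With \<open>G\<close> the formal inverse of \<open>F\<close>, the error \<open>1/f - G\<^sub>m\<close> equals \<open>(1 - f G\<^sub>m) / f\<close>, and the
  formal series of the numerator has no terms up to degree \<open>m\<close>.
\<close>

lemma expands_inverse:
  assumes f: "expands f F" and F: "F $ 0 \<noteq> 0"
  shows "expands (\<lambda>n. 1 / f n) (inverse F)"
  unfolding expands_def
proof
  fix m
  let ?e = "\<lambda>n. 1 / real n ^ Suc m" and ?G = "inverse F"
  let ?C = "Abs_fps (\<lambda>k. if k \<le> m then ?G $ k else 0)"
  have "expands (\<lambda>n. 1 - f n * psum ?G m n) (fps_const 1 - F * ?C)"
    by (intro expands_diff expands_const expands_mult f expands_psum)
  moreover have "(fps_const 1 - F * ?C) $ k = 0" if "k \<le> m" for k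
  proof -
    have "(F * ?C) $ k = (F * ?G) $ k"
      unfolding fps_mult_nth using that by (intro sum.cong) auto
    then show ?thesis using inverse_mult_eq_1'[OF F] by simp
  qed
  ultimately have "(\<lambda>n. 1 - f n * psum ?G m n) \<in> O(?e)"
    by (rule expands_bigo_vanishing)
  moreover have "(\<lambda>n. 1 / f n) \<in> O(\<lambda>_. 1)"
    using tendsto_divide[OF tendsto_const expands_tendsto[OF f] F, of 1]
    by (intro bigoI_tendsto[where c = "1 / F $ 0"]) auto
  ultimately have "(\<lambda>n. (1 - f n * psum ?G m n) * (1 / f n)) \<in> O(?e)"
    using landau_o.big_mult by fastforce
  moreover have "\<forall>\<^sub>F n in sequentially. (1 - f n * psum ?G m n) * (1 / f n) = 1 / f n - psum ?G m n"
    using tendsto_imp_eventually_ne[OF expands_tendsto[OF f] F]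
    by eventually_elim (simp add: field_simps)
  ultimately show "(\<lambda>n. 1 / f n - psum ?G m n) \<in> O(?e)"
    using landau_o.big.in_cong by fastforce
qed

text \<open>
  The same argument as for the inverse, with
  \<open>\<surd>f - G\<^sub>m = (f - G\<^sub>m\<^sup>2) / (\<surd>f + G\<^sub>m)\<close>; the positive constant term of \<open>G\<close> keeps the denominator away
  from zero.
\<close>

lemma expands_sqrt:
  assumes f: "expands f (G * G)" and G: "G $ 0 > 0" and nonneg: "\<And>n. f n \<ge> 0"
  shows "expands (\<lambda>n. sqrt (f n)) G"
  unfolding expands_def
proof
  fix m
  let ?e = "\<lambda>n. 1 / real n ^ Suc m"
  let ?C = "Abs_fps (\<lambda>k. if k \<le> m then G $ k else 0)"
  have "expands (\<lambda>n. f n - psum G m n * psum G m n) (G * G - ?C * ?C)"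
    by (intro expands_diff expands_mult f expands_psum)
  moreover have "(G * G - ?C * ?C) $ k = 0" if "k \<le> m" for k
  proof -
    have "(?C * ?C) $ k = (G * G) $ k"
      unfolding fps_mult_nth using that by (intro sum.cong) auto
    then show ?thesis by simp
  qed
  ultimately have "(\<lambda>n. f n - psum G m n * psum G m n) \<in> O(?e)"
    by (rule expands_bigo_vanishing)
  moreover have ev: "\<forall>\<^sub>F n in sequentially. psum G m n > G $ 0 / 2"
    using order_tendstoD(1)[OF psum_tendsto[of G m], of "G $ 0 / 2"] G by simp
  have "(\<lambda>n. 1 / (sqrt (f n) + psum G m n)) \<in> O(\<lambda>_. 1)"
  proof (rule bigoI[where c = "2 / G $ 0"])
    show "\<forall>\<^sub>F n in sequentially. norm (1 / (sqrt (f n) + psum G m n)) \<le> 2 / G $ 0 * norm (1::real)"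
      using ev
    proof eventually_elim
      case (elim n)
      have "sqrt (f n) + psum G m n \<ge> G $ 0 / 2" using elim nonneg[of n] by (smt (verit) real_sqrt_ge_zero)
      then show ?case using G by (simp add: field_simps)
    qed
  qed
  ultimately have "(\<lambda>n. (f n - psum G m n * psum G m n) * (1 / (sqrt (f n) + psum G m n))) \<in> O(?e)"
    using landau_o.big_mult by fastforce
  moreover have "\<forall>\<^sub>F n in sequentially.
      (f n - psum G m n * psum G m n) * (1 / (sqrt (f n) + psum G m n)) = sqrt (f n) - psum G m n"
    using ev
  proof eventually_elim
    case (elim n)
    have "sqrt (f n) + psum G m n > 0" using elim G nonneg[of n] by (smt (verit) real_sqrt_ge_zero half_gt_zero)
    moreover have "f n - psum G m n * psum G m n = (sqrt (f n) - psum G m n) * (sqrt (f n) + psum G m n)"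
      using nonneg[of n] by (simp add: algebra_simps)
    ultimately show ?case by simp
  qed
  ultimately show "(\<lambda>n. sqrt (f n) - psum G m n) \<in> O(?e)"
    using landau_o.big.in_cong by fastforce
qed

lemma expands_double:
  assumes "expands f F"
  shows "expands (\<lambda>n. f (2 * n)) (Abs_fps (\<lambda>k. F $ k / 2 ^ k))"
  unfolding expands_def
proof
  fix m
  have "filterlim (\<lambda>n::nat. 2 * n) sequentially sequentially"
    by (simp add: filterlim_subseq strict_mono_def)
  from landau_o.big.compose[OF expands_bigo[OF assms, of m] this]
  have "(\<lambda>n. f (2 * n) - psum F m (2 * n)) \<in> O(\<lambda>n. 1 / real (2 * n) ^ Suc m)" .
  also have "(\<lambda>n. 1 / real (2 * n) ^ Suc m) = (\<lambda>n. (1 / 2 ^ Suc m) * (1 / real n ^ Suc m))"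
    by (simp add: power_mult_distrib mult_ac)
  also have "O(\<dots>) = O(\<lambda>n. 1 / real n ^ Suc m)"
    by (rule landau_o.big.cmult) simp
  also have "(\<lambda>n. psum F m (2 * n)) = psum (Abs_fps (\<lambda>k. F $ k / 2 ^ k)) m"
    by (auto simp: psum_def power_mult_distrib)
  then have "(\<lambda>n. f (2 * n) - psum F m (2 * n)) =
      (\<lambda>n. f (2 * n) - psum (Abs_fps (\<lambda>k. F $ k / 2 ^ k)) m n)"
    by (metis (no_types))
  finally show "(\<lambda>n. f (2 * n) - psum (Abs_fps (\<lambda>k. F $ k / 2 ^ k)) m n) \<in> O(\<lambda>n. 1 / real n ^ Suc m)" .
qed

text \<open>
  Each coefficient of the limit is a finite sum since \<open>g\<^sub>k\<close> starts at order \<open>n\<^bsup>-k\<^esup>\<close>. The series of the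
  \<open>g\<^sub>k\<close> is itself understood asymptotically.
\<close>

lemma expands_series:
  assumes g: "\<And>k. expands (g k) (G k)" and G: "\<And>k i. i < k \<Longrightarrow> G k $ i = 0"
    and f: "\<And>m. (\<lambda>n. f n - (\<Sum>k\<le>m. g k n)) \<in> O(\<lambda>n. 1 / real n ^ Suc m)"
  shows "expands f (Abs_fps (\<lambda>i. \<Sum>k\<le>i. G k $ i))" (is "expands f ?F")
  unfolding expands_def
proof
  fix m
  let ?e = "\<lambda>n. 1 / real n ^ Suc m"
  have G': "i \<le> j" if "G i $ j \<noteq> 0" for i j
    using G that not_less by blast
  have "psum ?F m n = (\<Sum>k\<le>m. psum (G k) m n)" for n
  proof -
    have "psum ?F m n = (\<Sum>i\<le>m. \<Sum>k\<le>m. G k $ i / real n ^ i)"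
      unfolding psum_def by (intro sum.cong refl)
        (auto simp: sum_divide_distrib dest: G' intro!: sum.mono_neutral_left)
    also have "\<dots> = (\<Sum>k\<le>m. psum (G k) m n)"
      unfolding psum_def by (rule sum.swap)
    finally show ?thesis .
  qed
  then have eq: "f n - psum ?F m n = (f n - (\<Sum>k\<le>m. g k n)) + (\<Sum>k\<le>m. g k n - psum (G k) m n)" for n
    by (simp add: sum_subtractf)
  show "(\<lambda>n. f n - psum ?F m n) \<in> O(?e)"
    unfolding eq by (intro sum_in_bigo(1) f big_sum_in_bigo expands_bigo g)
qed

section \<open>Counting closed walks by splitting off a coordinate\<close>

text \<open>
  Counting walks by their end point makes the recursion over the first step available. The end point
  is constrained only in the first \<open>d\<close> coordinates, so that the same function can serve for
  dimensions \<open>d\<close> and \<open>d + 1\<close>.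
\<close>

definition walks_to :: "nat \<Rightarrow> nat \<Rightarrow> (nat \<Rightarrow> int) \<Rightarrow> (nat \<Rightarrow> int) list set" where
  "walks_to d l v =
     {w. length w = l \<and> set w \<subseteq> unit_steps d \<and> (\<forall>j<d. (\<Sum>s\<leftarrow>w. s j) = v j)}"

fun line_walks :: "nat \<Rightarrow> int \<Rightarrow> nat" where
  "line_walks 0 z = (if z = 0 then 1 else 0)"
| "line_walks (Suc l) z = line_walks l (z - 1) + line_walks l (z + 1)"

lemma line_walks_eq_0: "\<bar>z\<bar> > int l \<Longrightarrow> line_walks l z = 0"
  by (induction l arbitrary: z) auto

lemma line_walks_parity: "odd (int l + z) \<Longrightarrow> line_walks l z = 0"
  by (induction l arbitrary: z) auto

text \<open>
  Reaching \<open>2i - l\<close> in \<open>l\<close> steps means going up exactly \<open>i\<close> times.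
\<close>

lemma line_walks_binomial: "line_walks l (2 * int i - int l) = l choose i"
proof (induction l arbitrary: i)
  case 0
  then show ?case by (cases i) auto
next
  case (Suc l)
  show ?case
  proof (cases i)
    case 0
    then show ?thesis
      using Suc.IH[of 0] by (simp add: line_walks_eq_0 algebra_simps)
  next
    case (Suc j)
    then show ?thesis
      using Suc.IH[of j] Suc.IH[of "Suc j"] by (simp add: algebra_simps)
  qed
qed

lemma line_walks_return: "line_walks (2 * n) 0 = (2 * n) choose n"
  using line_walks_binomial[of "2 * n" n] by simp

lemma unit_steps_Suc:
  "unit_steps (Suc d) =
     unit_steps d \<union> {(\<lambda>j. if j = d then 1 else 0), (\<lambda>j. if j = d then -1 else 0)}"
  unfolding unit_steps_def by (auto simp: less_Suc_eq)

lemma unit_steps_0: "unit_steps 0 = {}"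
  by (simp add: unit_steps_def)

lemma finite_unit_steps: "finite (unit_steps d)"
  by (induction d) (auto simp: unit_steps_0 unit_steps_Suc)

lemma unit_steps_outside:
  assumes "s \<in> unit_steps d" "j \<ge> d"
  shows "s j = 0"
  using assms by (auto simp: unit_steps_def)

lemma finite_walks_to: "finite (walks_to d l v)"
  by (rule finite_subset[OF _ finite_lists_length_eq[OF finite_unit_steps[of d], of l]])
    (auto simp: walks_to_def)

lemma walks_to_cong: "(\<And>j. j < d \<Longrightarrow> v j = v' j) \<Longrightarrow> walks_to d l v = walks_to d l v'"
  by (auto simp: walks_to_def)

lemma card_walks_to_Suc:
  "card (walks_to d (Suc l) v) = (\<Sum>s\<in>unit_steps d. card (walks_to d l (\<lambda>j. v j - s j)))"
proof -
  have "walks_to d (Suc l) v = (\<Union>s\<in>unit_steps d. (#) s ` walks_to d l (\<lambda>j. v j - s j))"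
    unfolding walks_to_def by (auto simp: length_Suc_conv image_iff eq_diff_eq' algebra_simps)
  also have "card \<dots> = (\<Sum>s\<in>unit_steps d. card ((#) s ` walks_to d l (\<lambda>j. v j - s j)))"
    by (rule card_UN_disjoint) (auto simp: finite_unit_steps finite_walks_to)
  finally show ?thesis by (simp add: card_image)
qed

text \<open>
  In terms of exponential generating functions this is the product rule for derivatives.
\<close>

lemma pascal_convolution:
  fixes f h :: "nat \<Rightarrow> nat"
  shows "(\<Sum>k\<le>Suc l. (Suc l choose k) * f k * h (Suc l - k)) =
    (\<Sum>k\<le>l. (l choose k) * f (Suc k) * h (l - k)) + (\<Sum>k\<le>l. (l choose k) * f k * h (Suc (l - k)))"
proof -
  have "(\<Sum>k\<le>Suc l. (Suc l choose k) * f k * h (Suc l - k)) =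
      f 0 * h (Suc l) + (\<Sum>k\<le>l. (l choose k) * f (Suc k) * h (l - k)) +
      (\<Sum>k\<le>l. (l choose Suc k) * f (Suc k) * h (l - k))"
    by (subst sum.atMost_Suc_shift) (simp add: algebra_simps sum.distrib)
  moreover have "f 0 * h (Suc l) + (\<Sum>k\<le>l. (l choose Suc k) * f (Suc k) * h (l - k)) =
      (\<Sum>k\<le>Suc l. (l choose k) * f k * h (Suc l - k))"
    by (subst sum.atMost_Suc_shift) simp
  moreover have "\<dots> = (\<Sum>k\<le>l. (l choose k) * f k * h (Suc (l - k)))"
    by (simp add: Suc_diff_le)
  ultimately show ?thesis by simp
qed

text \<open>
  Choose the \<open>k\<close> steps that stay in the first \<open>d\<close> coordinates; they form a walk in dimension \<open>d\<close>, and
  the other steps form a walk on the line. The induction over the length replaces this bijection by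
  a computation: the first step either belongs to the first kind or moves the last coordinate.
\<close>

lemma card_walks_to_split:
  "card (walks_to (Suc d) l v) =
     (\<Sum>k\<le>l. (l choose k) * card (walks_to d k v) * line_walks (l - k) (v d))"
proof (induction l arbitrary: v)
  case 0
  have "walks_to d 0 v = (if \<forall>j<d. v j = 0 then {[]} else {})" for d
    by (auto simp: walks_to_def)
  then show ?case by (auto simp: less_Suc_eq)
next
  case (Suc l)
  let ?e = "\<lambda>c j. if j = d then c else (0::int)"
  let ?c = "\<lambda>d l v. card (walks_to d l v)"
  \<comment> \<open>In dimension \<open>d\<close> a step along the new axis does not affect the end point condition.\<close>
  have ignore: "?c d k (\<lambda>j. v j - ?e c j) = ?c d k v" for c k
    by (intro arg_cong[of _ _ card] walks_to_cong) auto
  have new: "unit_steps d \<inter> {?e 1, ?e (-1)} = {}" "?e 1 \<noteq> ?e (-1)"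
    by (auto dest: unit_steps_outside[of _ d d] fun_cong[of _ _ d])
  have "?c (Suc d) (Suc l) v = (\<Sum>s\<in>unit_steps d. ?c (Suc d) l (\<lambda>j. v j - s j)) +
      ?c (Suc d) l (\<lambda>j. v j - ?e 1 j) + ?c (Suc d) l (\<lambda>j. v j - ?e (-1) j)"
    unfolding card_walks_to_Suc[of "Suc d"] unit_steps_Suc
    using new by (subst sum.union_disjoint) (auto simp: finite_unit_steps)
  also have "(\<Sum>s\<in>unit_steps d. ?c (Suc d) l (\<lambda>j. v j - s j)) =
      (\<Sum>s\<in>unit_steps d. \<Sum>k\<le>l. (l choose k) * ?c d k (\<lambda>j. v j - s j) * line_walks (l - k) (v d))"
    by (rule sum.cong) (simp_all add: Suc.IH unit_steps_outside)
  also have "\<dots> = (\<Sum>k\<le>l. (l choose k) * ?c d (Suc k) v * line_walks (l - k) (v d))"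
    by (subst sum.swap) (simp add: card_walks_to_Suc[of d] sum_distrib_left sum_distrib_right)
  also have "?c (Suc d) l (\<lambda>j. v j - ?e 1 j) =
      (\<Sum>k\<le>l. (l choose k) * ?c d k v * line_walks (l - k) (v d - 1))"
    unfolding Suc.IH ignore by simp
  also have "?c (Suc d) l (\<lambda>j. v j - ?e (-1) j) =
      (\<Sum>k\<le>l. (l choose k) * ?c d k v * line_walks (l - k) (v d + 1))"
    unfolding Suc.IH ignore by simp
  finally show ?case
    unfolding pascal_convolution[of l "\<lambda>k. ?c d k v" "\<lambda>k. line_walks k (v d)"]
    by (simp add: sum.distrib algebra_simps)
qed

lemma num_closed_walks_Suc:
  "num_closed_walks (Suc d) l =
     (\<Sum>k\<le>l. (l choose k) * num_closed_walks d k * line_walks (l - k) 0)"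
proof -
  have "closed_walks d l = walks_to d l (\<lambda>_. 0)" for d l
    by (simp add: closed_walks_def walks_to_def)
  then show ?thesis
    using card_walks_to_split[of d l "\<lambda>_. 0"] by (simp add: num_closed_walks_def)
qed

text \<open>
  The walk in dimension \<open>0\<close> is empty, so only the term \<open>k = 0\<close> of the splitting formula remains.
\<close>

lemma num_closed_walks_1: "num_closed_walks 1 l = line_walks l 0"
proof -
  have 0: "num_closed_walks 0 k = (if k = 0 then 1 else 0)" for k
  proof -
    have "closed_walks 0 k = (if k = 0 then {[]} else {})"
      by (auto simp: closed_walks_def unit_steps_0)
    then show ?thesis by (simp add: num_closed_walks_def)
  qed
  have "num_closed_walks 1 l = (\<Sum>k\<le>l. if k = 0 then line_walks l 0 else 0)"
    unfolding One_nat_def num_closed_walks_Suc by (intro sum.cong refl) (simp add: 0)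
  then show ?thesis by simp
qed

text \<open>
  After division by the factorial the splitting formula is an ordinary convolution.
\<close>

lemma num_closed_walks_Suc_fact:
  "real (num_closed_walks (Suc d) l) / fact l =
     (\<Sum>k\<le>l. real (num_closed_walks d k) / fact k * (real (num_closed_walks 1 (l - k)) / fact (l - k)))"
  unfolding num_closed_walks_Suc num_closed_walks_1 of_nat_sum sum_divide_distrib
  by (intro sum.cong refl) (simp add: binomial_fact)

section \<open>Convolving reciprocal Gamma functions\<close>

text \<open>
  The coefficient of \<open>t\<^bsup>n\<^esup>\<close> in the formal expression \<open>t\<^bsup>-s\<^esup> e\<^bsup>ct\<^esup>\<close>, the exponential series being summed over
  the exponents \<open>n + s\<close>. These sequences form the asymptotic scale: raising \<open>s\<close> by one gains a factor
  of order \<open>1/n\<close>, and lowering \<open>c\<close> gains an exponential factor.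
\<close>

definition phi :: "real \<Rightarrow> real \<Rightarrow> nat \<Rightarrow> real" where
  "phi c s n = c powr (real n + s) / Gamma (real n + 1 + s)"

lemma phi_nonneg: "s \<ge> 0 \<Longrightarrow> phi c s n \<ge> 0"
  by (auto simp: phi_def intro!: divide_nonneg_nonneg less_imp_le[OF Gamma_real_pos])

lemma phi_pos: "c > 0 \<Longrightarrow> s \<ge> 0 \<Longrightarrow> phi c s n > 0"
  by (auto simp: phi_def intro!: divide_pos_pos Gamma_real_pos)

lemma phi_mono: "0 \<le> c \<Longrightarrow> c \<le> c' \<Longrightarrow> s \<ge> 0 \<Longrightarrow> phi c s n \<le> phi c' s n"
  unfolding phi_def by (intro divide_right_mono powr_mono2 less_imp_le[OF Gamma_real_pos]) auto

lemma Gamma_real_plus1: "x > 0 \<Longrightarrow> Gamma (x + 1 :: real) = x * Gamma x"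
  by (rule Gamma_plus1) (auto elim!: nonpos_Ints_cases)

lemma phi_Suc:
  assumes "c > 0" "s \<ge> 0"
  shows "phi c s (Suc n) = phi c s n * (c / (real n + 1 + s))"
proof -
  have "Gamma (real n + 1 + s + 1) = (real n + 1 + s) * Gamma (real n + 1 + s)"
    using assms by (intro Gamma_real_plus1) auto
  moreover have "c powr (real (Suc n) + s) = c powr (real n + s) * c"
    using assms powr_add[of c "real n + s" 1] by (simp add: add_ac)
  ultimately show ?thesis
    by (simp add: phi_def add_ac)
qed

lemma phi_plus1:
  assumes "c > 0" "s \<ge> 0"
  shows "phi c (s + 1) n = phi c s n * (c / (real n + 1 + s))"
  using phi_Suc[OF assms, of n] by (simp add: phi_def add_ac)

lemma phi_add_le:
  assumes "c > 0" "s \<ge> 0"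
  shows "phi c (s + real j) n \<le> c ^ j * phi c s n"
proof (induction j)
  case (Suc j)
  have "phi c (s + real (Suc j)) n = phi c (s + real j) n * (c / (real n + 1 + (s + real j)))"
    using phi_plus1[of c "s + real j" n] assms by (simp add: add_ac)
  also have "\<dots> \<le> phi c (s + real j) n * c"
    using assms by (intro mult_left_mono phi_nonneg) (auto simp: field_simps)
  also have "\<dots> \<le> c ^ j * phi c s n * c"
    using Suc.IH assms by (intro mult_right_mono) auto
  finally show ?case by (simp add: mult_ac)
qed simp

text \<open>
  The quotient of the two sequences satisfies the ratio test, its successive ratios tending to
  \<open>r / c < 1\<close>.
\<close>

lemma phi_dominated:
  assumes "0 < r" "r < c" "u \<ge> 0" "t \<ge> 0"
  shows "phi r u \<in> O[F](phi c t)"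
proof -
  define v where "v n = phi r u n / phi c t n" for n
  \<comment> \<open>A ratio strictly between the limit of the successive ratios and 1.\<close>
  define q where "q = (1 + r / c) / 2"
  have q: "r / c < q" "q < 1" using assms by (auto simp: q_def field_simps)
  have pos: "phi r u n > 0" "phi c t n > 0" for n
    using assms by (auto intro!: phi_pos)
  \<comment> \<open>Beyond this index the ratio of successive terms is below \<open>q\<close>, even with \<open>u\<close> replaced by 0.\<close>
  obtain n0 :: nat where n0: "t / (q * c / r - 1) < real n0"
    using reals_Archimedean2 by blast
  have "summable v"
  proof (rule summable_ratio_test[OF q(2)])
    fix n assume "n0 \<le> n"
    then have "t / (q * c / r - 1) < real n + 1" using n0 by linarith
    moreover have "q * c / r - 1 > 0" using q(1) assms by (simp add: field_simps)
    ultimately have "t < (real n + 1) * (q * c / r - 1)" by (simp add: pos_divide_less_eq)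
    then have "r * (real n + 1 + t) < q * c * (real n + 1)"
      using assms by (simp add: field_simps)
    also have "\<dots> \<le> q * c * (real n + 1 + u)"
      using q assms by (intro mult_left_mono mult_nonneg_nonneg) (auto simp: q_def)
    finally have "r * (real n + 1 + t) / (c * (real n + 1 + u)) \<le> q"
      using assms by (subst pos_divide_le_eq) (auto simp: mult_ac)
    then have *: "(r / (real n + 1 + u)) / (c / (real n + 1 + t)) \<le> q"
      by (simp add: mult_ac)
    have "v (Suc n) = v n * ((r / (real n + 1 + u)) / (c / (real n + 1 + t)))"
      using assms by (simp add: v_def phi_Suc mult_ac)
    also have "\<dots> \<le> v n * q"
      using * pos[of n] by (intro mult_left_mono) (auto simp: v_def)
    finally show "norm (v (Suc n)) \<le> q * norm (v n)"
      using pos[of n] pos[of "Suc n"] by (simp add: v_def mult_ac)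
  qed
  then have "Bseq v" using summable_LIMSEQ_zero convergent_imp_Bseq convergentI by blast
  then obtain C where C: "\<And>n. norm (v n) \<le> C" by (auto simp: Bseq_def)
  have "norm (phi r u n) \<le> C * norm (phi c t n)" for n
    using C[of n] pos[of n] by (simp add: v_def field_simps)
  then show ?thesis by (intro bigoI[where c = C] always_eventually) auto
qed

lemma has_integral_beta_scaled:
  assumes "p > 0" "q > 0" "c > (0::real)"
  shows "((\<lambda>x. x powr (p - 1) * (c - x) powr (q - 1)) has_integral c powr (p + q - 1) * Beta p q) {0..c}"
proof -
  have img: "(\<lambda>x. x / (1 / c)) ` {0..1} = {0..c}"
    using assms by (auto simp: image_iff field_simps intro!: bexI[of _ "_ / c"])
  have "((\<lambda>x. (1 / c * x) powr (p - 1) * (1 - 1 / c * x) powr (q - 1)) has_integral c * Beta p q) {0..c}"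
    using has_integral_stretch_real[OF has_integral_Beta_real[OF assms(1,2)], of "1 / c"] assms
    unfolding img by simp
  from has_integral_mult_right[OF this, of "c powr (p + q - 2)"]
  have "((\<lambda>x. c powr (p + q - 2) * ((1 / c * x) powr (p - 1) * (1 - 1 / c * x) powr (q - 1)))
      has_integral c powr (p + q - 1) * Beta p q) {0..c}"
    using assms powr_add[of c "p + q - 2" 1] by (simp add: mult_ac)
  then show ?thesis
  proof (rule has_integral_eq[rotated])
    fix x assume x: "x \<in> {0..c}"
    have "1 - 1 / c * x = (c - x) / c" using assms by (simp add: field_simps)
    then have "(1 / c * x) powr (p - 1) * (1 - 1 / c * x) powr (q - 1) =
        x powr (p - 1) * (c - x) powr (q - 1) / (c powr (p - 1) * c powr (q - 1))"
      using x assms by (simp add: powr_divide)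
    also have "c powr (p - 1) * c powr (q - 1) = c powr (p + q - 2)"
      by (simp flip: powr_add add: algebra_simps)
    finally show "c powr (p + q - 2) * ((1 / c * x) powr (p - 1) * (1 - 1 / c * x) powr (q - 1)) =
        x powr (p - 1) * (c - x) powr (q - 1)"
      using assms by simp
  qed
qed

text \<open>
  Up to the factor \<open>\<Gamma>(s)\<close>, the sequence \<open>n! \<phi>\<^sub>c\<^sub>,\<^sub>s(n)\<close> consists of the moments in \<open>c - x\<close> of the density
  \<open>x\<^bsup>s-1\<^esup>\<close> on \<open>[0, c]\<close>: a power law at the end of the support of a density produces one term of the
  scale.
\<close>

lemma phi_moment:
  assumes "s > 0" "c > 0"
  shows "((\<lambda>x. x powr (s - 1) * (c - x) ^ n) has_integral Gamma s * fact n * phi c s n) {0..c}"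
proof -
  have "((\<lambda>x. x powr (s - 1) * (c - x) powr (real n + 1 - 1)) has_integral
      c powr (s + (real n + 1) - 1) * Beta s (real n + 1)) {0..c}"
    using assms by (intro has_integral_beta_scaled) auto
  also have "c powr (s + (real n + 1) - 1) * Beta s (real n + 1) = Gamma s * fact n * phi c s n"
    by (simp add: Beta_def phi_def Gamma_fact[symmetric] add_ac)
  finally show ?thesis
    by (rule has_integral_spike_finite[rotated 2, of _ _ _ "{c}"]) (auto simp: powr_realpow)
qed

lemma phi_moment_0:
  assumes "s > 0" "c > 0"
  shows "((\<lambda>x. x powr (s - 1)) has_integral Gamma s * phi c s 0) {0..c}"
  using phi_moment[OF assms, of 0] by simp

text \<open>
  Shortening the interval of integration costs at most the integral of a majorant. The majorant
  dominates only on the removed part, but being nonnegative it may be integrated over the whole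
  interval, where its integral is known in closed form.
\<close>

lemma truncated_integral_bounds:
  fixes f g :: "real \<Rightarrow> real"
  assumes f: "(f has_integral I) {0..c}" "(f has_integral J) {0..b}" and b: "0 \<le> b" "b \<le> c"
    and g: "(g has_integral K) {0..c}" and fg: "\<And>x. x \<in> {b..c} \<Longrightarrow> 0 \<le> f x \<and> f x \<le> g x"
    and nonneg: "\<And>x. x \<in> {0..c} \<Longrightarrow> 0 \<le> g x"
  shows "0 \<le> I - J \<and> I - J \<le> K"
proof
  have int: "f integrable_on {b..c}" "g integrable_on {b..c}"
    using f(1) g b by (auto intro: integrable_subinterval_real has_integral_integrable)
  have "(f has_integral (J + integral {b..c} f)) {0..c}"
    using b f(2) int(1) by (intro has_integral_combine[OF b]) (auto simp: integrable_integral)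
  then have eq: "I - J = integral {b..c} f"
    using has_integral_unique[OF f(1)] by fastforce
  show "0 \<le> I - J" unfolding eq using fg by (intro integral_nonneg int) auto
  have "integral {b..c} f \<le> integral {b..c} g" using fg by (intro integral_le int) auto
  also have "\<dots> \<le> integral {0..c} g"
    using b g nonneg by (intro integral_subset_le int) (auto intro: has_integral_integrable)
  also have "\<dots> = K" using g by (rule integral_unique)
  finally show "I - J \<le> K" unfolding eq .
qed

text \<open>
  The coefficient at \<open>t\<^bsup>n\<^esup>\<close> of \<open>e\<^bsup>wt\<^esup>\<close> times the generating function of \<open>\<phi>\<^sub>b\<^sub>,\<^sub>s\<close>. Formally the result is
  \<open>\<phi>\<close> with \<open>c = b + w\<close>. Integrating over \<open>w\<close> later turns the exponential factor into another \<open>\<phi>\<close>.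
\<close>

definition phi_transform :: "real \<Rightarrow> real \<Rightarrow> real \<Rightarrow> nat \<Rightarrow> real" where
  "phi_transform b s w n = (\<Sum>k\<le>n. w ^ k / fact k * phi b s (n - k))"

lemma phi_transform_integral:
  assumes "s > 0" "b > 0"
  shows "((\<lambda>y. y powr (s - 1) * (b + w - y) ^ n) has_integral Gamma s * fact n * phi_transform b s w n) {0..b}"
proof -
  have "((\<lambda>y. \<Sum>k\<le>n. real (n choose k) * w ^ k * (y powr (s - 1) * (b - y) ^ (n - k))) has_integral
      (\<Sum>k\<le>n. real (n choose k) * w ^ k * (Gamma s * fact (n - k) * phi b s (n - k)))) {0..b}"
    by (intro has_integral_sum has_integral_mult_right phi_moment assms) auto
  also have "(\<Sum>k\<le>n. real (n choose k) * w ^ k * (Gamma s * fact (n - k) * phi b s (n - k))) =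
      Gamma s * fact n * phi_transform b s w n"
    unfolding phi_transform_def sum_distrib_left
    by (intro sum.cong refl) (simp add: binomial_fact)
  also have "(\<lambda>y. \<Sum>k\<le>n. real (n choose k) * w ^ k * (y powr (s - 1) * (b - y) ^ (n - k))) =
      (\<lambda>y. y powr (s - 1) * (b + w - y) ^ n)"
  proof
    fix y
    have "(b + w - y) ^ n = (\<Sum>k\<le>n. real (n choose k) * w ^ k * (b - y) ^ (n - k))"
      using binomial_ring[of w "b - y" n] by (simp add: algebra_simps)
    then show "(\<Sum>k\<le>n. real (n choose k) * w ^ k * (y powr (s - 1) * (b - y) ^ (n - k))) =
        y powr (s - 1) * (b + w - y) ^ n"
      by (simp add: sum_distrib_left mult_ac)
  qed
  finally show ?thesis .
qed

text \<open>
  Up to the factor \<open>\<Gamma>(s) n!\<close>, the transform and \<open>\<phi>\<close> are the integrals of \<open>y\<^bsup>s-1\<^esup> (b + w - y)\<^bsup>n\<^esup>\<close> over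
  \<open>[0, b]\<close> and \<open>[0, b + w]\<close>. On the difference of these intervals the power is at most \<open>w\<^bsup>n\<^esup>\<close>, which is
  exponentially smaller than \<open>(b + w)\<^bsup>n\<^esup>\<close>.
\<close>

lemma phi_transform_bounds:
  assumes "s > 0" "b > 0" "0 \<le> w"
  shows "phi_transform b s w n \<le> phi (b + w) s n"
    "phi (b + w) s n - phi_transform b s w n \<le> w ^ n / fact n * phi (b + w) s 0"
proof -
  have "b + w > 0" using assms by simp
  note bounds = truncated_integral_bounds[OF phi_moment[OF assms(1) this]
      phi_transform_integral[OF assms(1,2)] _ _ has_integral_mult_right[OF phi_moment_0[OF assms(1) this]]]
  have "0 \<le> Gamma s * fact n * phi (b + w) s n - Gamma s * fact n * phi_transform b s w n \<and>
      Gamma s * fact n * phi (b + w) s n - Gamma s * fact n * phi_transform b s w n \<le>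
      w ^ n * (Gamma s * phi (b + w) s 0)"
    using assms by (intro bounds)
      (auto simp: mult.commute intro!: mult_right_mono mult_left_mono power_mono)
  moreover have "Gamma s > 0" "fact n > (0::real)" using assms by auto
  ultimately have *: "0 \<le> (Gamma s * fact n) * (phi (b + w) s n - phi_transform b s w n)"
    "(Gamma s * fact n) * (phi (b + w) s n - phi_transform b s w n) \<le>
      (Gamma s * fact n) * (w ^ n / fact n * phi (b + w) s 0)"
    "Gamma s * fact n > 0"
    by (simp_all add: algebra_simps)
  show "phi_transform b s w n \<le> phi (b + w) s n"
    using *(1,3) by (metis diff_ge_0_iff_ge mult_zero_right mult_le_cancel_left_pos)
  show "phi (b + w) s n - phi_transform b s w n \<le> w ^ n / fact n * phi (b + w) s 0"
    using *(2,3) by (metis mult_le_cancel_left_pos)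
qed

text \<open>
  For the argument \<open>- w\<close> the integrand \<open>(b - w - y)\<^bsup>n\<^esup>\<close> stays below the \<open>n\<close>-th power of the larger of \<open>b\<close>
  and \<open>w\<close>. Hence signs \<open>(-1)\<^bsup>k\<^esup>\<close> make the contribution exponentially small.
\<close>

lemma phi_transform_alternating_bound:
  assumes "s > 0" "b > 0" "0 \<le> w" "b \<le> r" "w \<le> r"
  shows "\<bar>phi_transform b s (- w) n\<bar> \<le> r ^ n / fact n * phi b s 0"
proof -
  have "norm (integral {0..b} (\<lambda>y. y powr (s - 1) * (b + - w - y) ^ n)) \<le>
      integral {0..b} (\<lambda>y. r ^ n * y powr (s - 1))"
  proof (rule integral_norm_bound_integral)
    fix y assume "y \<in> {0..b}"
    then have "\<bar>b + - w - y\<bar> \<le> r" using assms by auto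
    then have "\<bar>b + - w - y\<bar> ^ n \<le> r ^ n" by (intro power_mono) auto
    then show "norm (y powr (s - 1) * (b + - w - y) ^ n) \<le> r ^ n * y powr (s - 1)"
      by (simp add: abs_mult power_abs mult.commute[of "y powr _"] mult_right_mono)
  qed (use has_integral_integrable[OF phi_transform_integral[OF assms(1,2), of "- w"]]
      has_integral_integrable[OF has_integral_mult_right[OF phi_moment_0[OF assms(1,2)]]] in auto)
  then have "\<bar>Gamma s * fact n * phi_transform b s (- w) n\<bar> \<le> r ^ n * (Gamma s * phi b s 0)"
    unfolding integral_unique[OF phi_transform_integral[OF assms(1,2), of "- w"]]
      integral_unique[OF has_integral_mult_right[OF phi_moment_0[OF assms(1,2)]]] by simp
  then have "(Gamma s * fact n) * \<bar>phi_transform b s (- w) n\<bar> \<le> (Gamma s * fact n) * (r ^ n / fact n * phi b s 0)"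
    using assms Gamma_real_pos[of s] by (simp add: abs_mult mult_ac)
  then show ?thesis
    using assms by (subst (asm) mult_le_cancel_left_pos) auto
qed

lemma phi_convolution_integral:
  assumes "s > 0" "a > 0"
  shows "((\<lambda>x. x powr (s - 1) * phi_transform b s' (e * (a - x)) n) has_integral
     Gamma s * (\<Sum>k\<le>n. e ^ k * phi a s k * phi b s' (n - k))) {0..a}"
proof -
  have "((\<lambda>x. \<Sum>k\<le>n. e ^ k / fact k * phi b s' (n - k) * (x powr (s - 1) * (a - x) ^ k)) has_integral
      (\<Sum>k\<le>n. e ^ k / fact k * phi b s' (n - k) * (Gamma s * fact k * phi a s k))) {0..a}"
    by (intro has_integral_sum has_integral_mult_right phi_moment assms) auto
  also have "(\<Sum>k\<le>n. e ^ k / fact k * phi b s' (n - k) * (Gamma s * fact k * phi a s k)) =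
      Gamma s * (\<Sum>k\<le>n. e ^ k * phi a s k * phi b s' (n - k))"
    unfolding sum_distrib_left by (intro sum.cong refl) simp
  also have "(\<lambda>x. \<Sum>k\<le>n. e ^ k / fact k * phi b s' (n - k) * (x powr (s - 1) * (a - x) ^ k)) =
      (\<lambda>x. x powr (s - 1) * phi_transform b s' (e * (a - x)) n)"
    unfolding phi_transform_def sum_distrib_left by (auto simp: power_mult_distrib mult_ac)
  finally show ?thesis .
qed

lemma phi_beta_integral:
  assumes "s > 0" "s' > 0" "c > 0"
  shows "((\<lambda>x. x powr (s - 1) * phi (c - x) s' n) has_integral Gamma s * phi c (s + s') n) {0..c}"
proof -
  have g: "Gamma (real n + 1 + s') > 0" using assms by (intro Gamma_real_pos) auto
  have "((\<lambda>x. x powr (s - 1) * (c - x) powr (real n + 1 + s' - 1)) has_integral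
      c powr (s + (real n + 1 + s') - 1) * Beta s (real n + 1 + s')) {0..c}"
    using assms by (intro has_integral_beta_scaled) auto
  from has_integral_mult_left[OF this, of "1 / Gamma (real n + 1 + s')"] g show ?thesis
    by (simp add: phi_def Beta_def add_ac mult_ac)
qed

text \<open>
  Replace the transform by \<open>\<phi>\<close> in the integral representation of the convolution and extend the
  integral from \<open>[0, a]\<close> to \<open>[0, a + b]\<close>, where it is a Beta integral. Both changes increase the
  value, so the convolution is bounded by its main term without any constant, and both cost only
  exponentially small amounts.
\<close>

lemma phi_convolution_bounds:
  fixes n :: nat
  assumes s: "s > 0" "s' > 0" and ab: "a > 0" "b > 0"
  defines "S \<equiv> \<Sum>k\<le>n. phi a s k * phi b s' (n - k)"
  shows "S \<le> phi (a + b) (s + s') n"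
    and "phi (a + b) (s + s') n - S \<le> phi (a + b) s 0 * phi b s' n + phi a s 0 * phi (a + b) s' 0 * (a ^ n / fact n)"
proof -
  let ?c = "a + b" and ?f = "\<lambda>x. x powr (s - 1) * phi (a + b - x) s' n"
  have c: "?c > 0" using ab by simp
  note I = phi_beta_integral[OF s c, of n]
  have "?f integrable_on {0..a}"
    using has_integral_integrable[OF I] ab by (auto intro: integrable_subinterval_real)
  then obtain J where J: "(?f has_integral J) {0..a}" by (auto simp: integrable_on_def)
  have "?f x \<le> phi b s' n * x powr (s - 1)" if "x \<in> {a..?c}" for x
  proof -
    have "phi (?c - x) s' n \<le> phi b s' n" using that s by (intro phi_mono) auto
    from mult_right_mono[OF this, of "x powr (s - 1)"] show ?thesis by (simp add: mult.commute)
  qed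
  then have 1: "0 \<le> Gamma s * phi ?c (s + s') n - J \<and>
      Gamma s * phi ?c (s + s') n - J \<le> phi b s' n * (Gamma s * phi ?c s 0)"
    using s ab
    by (intro truncated_integral_bounds[OF I J _ _ has_integral_mult_right[OF phi_moment_0[OF s(1) c]]])
      (auto intro!: mult_nonneg_nonneg phi_nonneg)
  have D: "((\<lambda>x. ?f x - x powr (s - 1) * phi_transform b s' (a - x) n) has_integral (J - Gamma s * S)) {0..a}"
    using has_integral_diff[OF J phi_convolution_integral[OF s(1) ab(1), of b s' 1 n]] by (simp add: S_def)
  have tr: "phi_transform b s' (a - x) n \<le> phi (?c - x) s' n \<and>
      phi (?c - x) s' n - phi_transform b s' (a - x) n \<le> a ^ n / fact n * phi ?c s' 0"
    if x: "x \<in> {0..a}" for x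
  proof -
    have "(a - x) ^ n / fact n * phi (b + (a - x)) s' 0 \<le> a ^ n / fact n * phi ?c s' 0"
      using x ab s by (intro mult_mono divide_right_mono power_mono phi_mono phi_nonneg) auto
    then show ?thesis
      using phi_transform_bounds[OF s(2) ab(2), of "a - x" n] x by (simp add: algebra_simps)
  qed
  have 2: "0 \<le> J - Gamma s * S"
    using tr by (intro has_integral_nonneg[OF D]) (auto intro!: mult_left_mono)
  have 3: "J - Gamma s * S \<le> a ^ n / fact n * phi ?c s' 0 * (Gamma s * phi a s 0)"
  proof (rule has_integral_le[OF D has_integral_mult_right[OF phi_moment_0[OF s(1) ab(1)]]])
    fix x assume "x \<in> {0..a}"
    with tr have "x powr (s - 1) * (phi (?c - x) s' n - phi_transform b s' (a - x) n) \<le>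
        x powr (s - 1) * (a ^ n / fact n * phi ?c s' 0)"
      by (intro mult_left_mono) auto
    then show "?f x - x powr (s - 1) * phi_transform b s' (a - x) n \<le> a ^ n / fact n * phi ?c s' 0 * x powr (s - 1)"
      by (simp add: algebra_simps)
  qed
  have g: "Gamma s > 0" using s by simp
  have "Gamma s * S \<le> Gamma s * phi ?c (s + s') n" using 1 2 by simp
  then show "S \<le> phi ?c (s + s') n" using g by simp
  have "Gamma s * (phi ?c (s + s') n - S) \<le>
      Gamma s * (phi ?c s 0 * phi b s' n + phi a s 0 * phi ?c s' 0 * (a ^ n / fact n))"
    using 1 3 by (simp add: algebra_simps)
  then show "phi ?c (s + s') n - S \<le> phi ?c s 0 * phi b s' n + phi a s 0 * phi ?c s' 0 * (a ^ n / fact n)"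
    using g by simp
qed

text \<open>
  Together with \<open>phi_convolution_bounds\<close> this isolates the even indices, where alternating and plain
  convolution add up.
\<close>

lemma phi_alternating_convolution_bound:
  assumes s: "s > 0" "s' > 0" and ab: "a > 0" "b > 0"
  shows "\<bar>\<Sum>k\<le>n. (-1) ^ k * phi a s k * phi b s' (n - k)\<bar> \<le> phi a s 0 * phi b s' 0 * (max a b ^ n / fact n)"
proof -
  let ?T = "\<Sum>k\<le>n. (-1) ^ k * phi a s k * phi b s' (n - k)"
  note I = phi_convolution_integral[OF s(1) ab(1), of b s' "-1" n]
  let ?M = "max a b ^ n / fact n * phi b s' 0"
  note K = has_integral_mult_right[OF phi_moment_0[OF s(1) ab(1)], of ?M]
  have "norm (integral {0..a} (\<lambda>x. x powr (s - 1) * phi_transform b s' (- 1 * (a - x)) n)) \<le>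
      integral {0..a} (\<lambda>x. ?M * x powr (s - 1))"
  proof (rule integral_norm_bound_integral)
    fix x assume x: "x \<in> {0..a}"
    have "\<bar>phi_transform b s' (- (a - x)) n\<bar> \<le> ?M"
      using x ab s by (intro phi_transform_alternating_bound) auto
    then have "\<bar>phi_transform b s' (- (a - x)) n\<bar> * x powr (s - 1) \<le> ?M * x powr (s - 1)"
      by (rule mult_right_mono) simp
    moreover have "norm (x powr (s - 1) * phi_transform b s' (- 1 * (a - x)) n) =
        \<bar>phi_transform b s' (- (a - x)) n\<bar> * x powr (s - 1)"
      by (simp only: real_norm_def abs_mult mult_minus1) simp
    ultimately show "norm (x powr (s - 1) * phi_transform b s' (- 1 * (a - x)) n) \<le> ?M * x powr (s - 1)"
      by simp
  qed (use I K in \<open>auto intro: has_integral_integrable\<close>)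
  then have "\<bar>Gamma s * ?T\<bar> \<le> ?M * (Gamma s * phi a s 0)"
    unfolding integral_unique[OF I] integral_unique[OF K] by simp
  then have "Gamma s * \<bar>?T\<bar> \<le> Gamma s * (phi a s 0 * phi b s' 0 * (max a b ^ n / fact n))"
    using s by (simp add: abs_mult mult_ac)
  moreover have "Gamma s > 0" using s by simp
  ultimately show ?thesis by (metis mult_le_cancel_left_pos)
qed

lemma bigo_cmult: 
  fixes f :: "'a \<Rightarrow> real"
  shows "f \<in> O[F](g) \<Longrightarrow> (\<lambda>x. c * f x) \<in> O[F](g)"
  by (cases "c = 0") auto

text \<open>
  Landau symbols along this filter are bounds that hold with one constant for all even numbers, not
  only for large ones. This matters because a convolution involves the small indices too.
\<close>

abbreviation evens :: "nat filter" where
  "evens \<equiv> principal {n. even n}"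

definition even_convolution :: "(nat \<Rightarrow> real) \<Rightarrow> (nat \<Rightarrow> real) \<Rightarrow> nat \<Rightarrow> real" where
  "even_convolution f g n = (\<Sum>k\<le>n. if even k then f k * g (n - k) else 0)"

text \<open>
  The sum over even indices is half the sum of the plain and the alternating convolution. The first
  agrees with its main term up to an exponentially small error and the second is exponentially small,
  so the error is below \<open>\<phi>\<^sub>a\<^sub>+\<^sub>b\<^sub>,\<^sub>t\<close> for every \<open>t\<close>.
\<close>

lemma phi_convolution_asymp:
  assumes s: "s > 0" "s' > 0" and ab: "a > 0" "b > 0" and t: "t \<ge> 0"
  shows "(\<lambda>n. 2 * even_convolution (phi a s) (phi b s') n - phi (a + b) (s + s') n)
    \<in> O[evens](phi (a + b) t)"
proof -
  let ?c = "a + b" and ?S = "\<lambda>n. \<Sum>k\<le>n. phi a s k * phi b s' (n - k)"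
  let ?T = "\<lambda>n. \<Sum>k\<le>n. (-1) ^ k * phi a s k * phi b s' (n - k)"
  let ?O = "O[evens](phi ?c t)"
  have small: "phi r u \<in> ?O" if "0 < r" "r < ?c" "u \<ge> 0" for r u
    using that t by (rule phi_dominated)
  have pow: "(\<lambda>n. r ^ n / fact n) \<in> ?O" if "0 < r" "r < ?c" for r
  proof -
    have "(\<lambda>n. r ^ n / fact n) = phi r 0"
      using that by (auto simp: phi_def powr_realpow Gamma_fact[symmetric] add_ac)
    with small[OF that, of 0] show ?thesis by simp
  qed
  have "(\<lambda>n. phi ?c (s + s') n - ?S n) \<in> ?O"
  proof (rule landau_o.big_trans[OF bigoI[where c = 1]])
    show "\<forall>\<^sub>F n in evens. norm (phi ?c (s + s') n - ?S n) \<le> 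
        1 * norm (phi ?c s 0 * phi b s' n + phi a s 0 * phi ?c s' 0 * (a ^ n / fact n))"
      using phi_convolution_bounds[OF s ab]
      by (intro always_eventually allI) (smt (verit) real_norm_def)
    show "(\<lambda>n. phi ?c s 0 * phi b s' n + phi a s 0 * phi ?c s' 0 * (a ^ n / fact n)) \<in> ?O"
      using s ab by (intro sum_in_bigo(1)[OF bigo_cmult bigo_cmult]) (auto intro!: small pow)
  qed
  moreover have "?T \<in> ?O"
  proof (rule landau_o.big_trans[OF bigoI[where c = 1]])
    show "\<forall>\<^sub>F n in evens. norm (?T n) \<le> 1 * norm (phi a s 0 * phi b s' 0 * (max a b ^ n / fact n))"
      using phi_alternating_convolution_bound[OF s ab]
      by (intro always_eventually allI) (smt (verit) real_norm_def)
    show "(\<lambda>n. phi a s 0 * phi b s' 0 * (max a b ^ n / fact n)) \<in> ?O"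
      using ab by (intro bigo_cmult pow) auto
  qed
  ultimately have "(\<lambda>n. ?T n - (phi ?c (s + s') n - ?S n)) \<in> ?O"
    by (rule sum_in_bigo(2)[rotated])
  also have "(\<lambda>n. ?T n - (phi ?c (s + s') n - ?S n)) =
      (\<lambda>n. 2 * even_convolution (phi a s) (phi b s') n - phi ?c (s + s') n)"
  proof
    fix n
    have "2 * even_convolution (phi a s) (phi b s') n = ?S n + ?T n"
      unfolding even_convolution_def sum_distrib_left sum.distrib[symmetric]
      by (intro sum.cong refl) auto
    then show "?T n - (phi ?c (s + s') n - ?S n) =
        2 * even_convolution (phi a s) (phi b s') n - phi ?c (s + s') n" by simp
  qed
  finally show ?thesis .
qed

text \<open>
  As \<open>\<phi>\<close> is positive, one may convolve the bounds for the absolute values, and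
  \<open>phi_convolution_bounds\<close> bounds the result without losing anything.
\<close>

lemma even_convolution_bigo:
  assumes s: "s > 0" "s' > 0" and ab: "a > 0" "b > 0"
    and f: "f \<in> O[evens](phi a s)" and g: "g \<in> O[evens](phi b s')"
  shows "even_convolution f g \<in> O[evens](phi (a + b) (s + s'))"
proof -
  obtain C where C: "C > 0" "\<And>n. even n \<Longrightarrow> norm (f n) \<le> C * norm (phi a s n)"
    using f by (auto elim!: landau_o.bigE simp: eventually_principal)
  obtain D where D: "D > 0" "\<And>n. even n \<Longrightarrow> norm (g n) \<le> D * norm (phi b s' n)"
    using g by (auto elim!: landau_o.bigE simp: eventually_principal)
  have pos: "phi a s n \<ge> 0" "phi b s' n \<ge> 0" for n
    using s by (auto intro!: phi_nonneg)
  have "norm (even_convolution f g n) \<le> C * D * norm (phi (a + b) (s + s') n)" if "even n" for n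
  proof -
    have "norm (even_convolution f g n) \<le> (\<Sum>k\<le>n. C * D * (phi a s k * phi b s' (n - k)))"
      unfolding even_convolution_def
    proof (rule order_trans[OF norm_sum sum_mono])
      fix k assume "k \<in> {..n}"
      then have "\<bar>f k\<bar> * \<bar>g (n - k)\<bar> \<le> (C * phi a s k) * (D * phi b s' (n - k))" if "even k"
        using C(2)[of k] D(2)[of "n - k"] that \<open>even n\<close> pos C(1) by (intro mult_mono) auto
      then show "norm (if even k then f k * g (n - k) else 0) \<le> C * D * (phi a s k * phi b s' (n - k))"
        using C(1) D(1) pos by (auto simp: abs_mult mult_ac)
    qed
    also have "\<dots> \<le> C * D * phi (a + b) (s + s') n"
      unfolding sum_distrib_left[symmetric] using C(1) D(1)
      by (intro mult_left_mono phi_convolution_bounds s ab) auto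
    finally show ?thesis using s by (simp add: phi_nonneg)
  qed
  then show ?thesis by (intro bigoI[where c = "C * D"]) (auto simp: eventually_principal)
qed

definition phi_sum :: "real \<Rightarrow> real \<Rightarrow> real fps \<Rightarrow> nat \<Rightarrow> nat \<Rightarrow> real" where
  "phi_sum c s B m n = 2 * (\<Sum>k\<le>m. B $ k * phi c (s + real k) n)"

text \<open>
  The factor \<open>2\<close> in \<open>phi_sum\<close> accounts for \<open>a\<close> being of interest at even indices only: it makes
  \<open>B\<close> multiplicative under convolution.
\<close>

definition egf_expands :: "real \<Rightarrow> real \<Rightarrow> real fps \<Rightarrow> (nat \<Rightarrow> real) \<Rightarrow> bool" where
  "egf_expands c s B a \<longleftrightarrow>
     (\<forall>m. (\<lambda>n. a n - phi_sum c s B m n) \<in> O[evens](phi c (s + real (Suc m))))"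

lemma phi_bigo:
  assumes "c > 0" "s \<ge> 0" "i \<le> j"
  shows "phi c (s + real j) \<in> O[F](phi c (s + real i))"
proof (intro bigoI[where c = "c ^ (j - i)"] always_eventually allI)
  fix n
  show "norm (phi c (s + real j) n) \<le> c ^ (j - i) * norm (phi c (s + real i) n)"
    using phi_add_le[of c "s + real i" "j - i" n] assms by (simp add: phi_nonneg of_nat_diff)
qed

lemma phi_sum_bigo:
  assumes "c > 0" "s \<ge> 0"
  shows "phi_sum c s B m \<in> O[F](phi c s)"
  unfolding phi_sum_def[abs_def]
  using phi_bigo[OF assms, of 0] by (intro bigo_cmult big_sum_in_bigo) simp

lemma even_convolution_phi_sum:
  "even_convolution (phi_sum a s B m) (phi_sum b s' B' m) n =
     2 * (\<Sum>(i, j)\<in>{..m} \<times> {..m}. B $ i * B' $ j *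
       (2 * even_convolution (phi a (s + real i)) (phi b (s' + real j)) n))"
proof -
  have "even_convolution (phi_sum a s B m) (phi_sum b s' B' m) n =
      (\<Sum>k\<le>n. \<Sum>(i, j)\<in>{..m} \<times> {..m}. B $ i * B' $ j * 4 *
        (if even k then phi a (s + real i) k * phi b (s' + real j) (n - k) else 0))"
    unfolding even_convolution_def
  proof (intro sum.cong refl)
    fix k
    have "phi_sum a s B m k * phi_sum b s' B' m (n - k) =
        (\<Sum>(i, j)\<in>{..m} \<times> {..m}. B $ i * B' $ j * 4 * (phi a (s + real i) k * phi b (s' + real j) (n - k)))"
    proof -
      have 4: "(2 * x) * (2 * y) = 4 * (x * y)" for x y :: real by simp
      show ?thesis
        unfolding phi_sum_def 4 sum.cartesian_product[symmetric]
        unfolding sum_product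
        unfolding sum_distrib_left
        by (intro sum.cong refl) simp
    qed
    then show "(if even k then phi_sum a s B m k * phi_sum b s' B' m (n - k) else 0) =
        (\<Sum>(i, j)\<in>{..m} \<times> {..m}. B $ i * B' $ j * 4 *
        (if even k then phi a (s + real i) k * phi b (s' + real j) (n - k) else 0))"
      by simp
  qed
  then show ?thesis
    by (subst (asm) sum.swap)
      (simp add: even_convolution_def sum_distrib_left case_prod_unfold mult_ac)
qed

text \<open>
  Split each factor into its truncated series and a remainder. The products of remainders are
  controlled by \<open>even_convolution_bigo\<close>, the products of truncated series are convolved term by term,
  and the pairs \<open>(i, j)\<close> with \<open>i + j > m\<close> are of the size of the error.
\<close>

theorem egf_expands_convolution:
  assumes s: "s > 0" "s' > 0" and ab: "a > 0" "b > 0"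
    and u: "egf_expands a s B u" and v: "egf_expands b s' B' v"
  shows "egf_expands (a + b) (s + s') (B * B') (even_convolution u v)"
  unfolding egf_expands_def
proof
  fix m
  let ?c = "a + b" and ?P = "phi_sum a s B m" and ?Q = "phi_sum b s' B' m"
  let ?R = "\<lambda>n. u n - ?P n" and ?R' = "\<lambda>n. v n - ?Q n"
  let ?O = "O[evens](phi ?c (s + s' + real (Suc m)))"
  have R: "?R \<in> O[evens](phi a (s + real (Suc m)))" "?R' \<in> O[evens](phi b (s' + real (Suc m)))"
    using u v by (auto simp: egf_expands_def)
  have P: "?P \<in> O[evens](phi a s)" "?Q \<in> O[evens](phi b s')"
    using s ab by (auto intro!: phi_sum_bigo)
  have v_bigo: "v \<in> O[evens](phi b s')"
  proof -
    have "?R' \<in> O[evens](phi b s')"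
      using landau_o.big_trans[OF R(2) phi_bigo[of b s' 0 "Suc m"]] s ab by simp
    from sum_in_bigo(1)[OF this P(2)] show ?thesis by simp
  qed
  define t where "t n = (\<lambda>(i, j). B $ i * B' $ j * phi ?c (s + s' + real (i + j)) n)" for n
  let ?S = "{..m} \<times> {..m}" and ?T = "{(i, j). i + j \<le> m}"
  have sub: "?T \<subseteq> ?S" by auto
  have 1: "even_convolution ?R v \<in> ?O"
    using even_convolution_bigo[OF _ _ ab R(1) v_bigo] s by (simp add: add_ac)
  have 2: "even_convolution ?P ?R' \<in> ?O"
    using even_convolution_bigo[OF _ _ ab P(1) R(2)] s by (simp add: add_ac)
  have 3: "(\<lambda>n. even_convolution ?P ?Q n - 2 * sum (t n) ?S) \<in> ?O"
  proof -
    have "(\<lambda>n. 2 * (\<Sum>p\<in>?S. case p of (i, j) \<Rightarrow> B $ i * B' $ j *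
       (2 * even_convolution (phi a (s + real i)) (phi b (s' + real j)) n -
        phi ?c ((s + real i) + (s' + real j)) n))) \<in> ?O"
      using s ab
      by (intro bigo_cmult big_sum_in_bigo)
        (auto split: prod.splits intro!: bigo_cmult phi_convolution_asymp)
    moreover have "even_convolution ?P ?Q n - 2 * sum (t n) ?S =
      2 * (\<Sum>p\<in>?S. case p of (i, j) \<Rightarrow> B $ i * B' $ j *
       (2 * even_convolution (phi a (s + real i)) (phi b (s' + real j)) n -
        phi ?c ((s + real i) + (s' + real j)) n))" for n
      unfolding even_convolution_phi_sum t_def right_diff_distrib[symmetric] sum_subtractf[symmetric]
      by (intro arg_cong[of _ _ "(*) 2"] sum.cong refl) (auto simp: algebra_simps)
    ultimately show ?thesis by simp
  qed
  have 4: "(\<lambda>n. 2 * sum (t n) (?S - ?T)) \<in> ?O"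
  proof -
    have "(\<lambda>n. t n p) \<in> ?O" if p: "p \<in> ?S - ?T" for p
    proof -
      obtain i j where ij: "p = (i, j)" "Suc m \<le> i + j" using p by (cases p) auto
      have "phi ?c (s + s' + real (i + j)) \<in> ?O"
        using s ab ij by (intro phi_bigo) auto
      from bigo_cmult[OF this] show ?thesis
        unfolding t_def ij(1) prod.case .
    qed
    then show ?thesis by (intro bigo_cmult big_sum_in_bigo) auto
  qed
  have eq: "even_convolution u v n - phi_sum ?c (s + s') (B * B') m n =
      even_convolution ?R v n + even_convolution ?P ?R' n +
      (even_convolution ?P ?Q n - 2 * sum (t n) ?S) + 2 * sum (t n) (?S - ?T)" for n
  proof -
    have "even_convolution u v n = even_convolution ?R v n + even_convolution ?P ?R' n + even_convolution ?P ?Q n"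
      unfolding even_convolution_def sum.distrib[symmetric]
      by (intro sum.cong refl) (auto simp: algebra_simps)
    moreover have "phi_sum ?c (s + s') (B * B') m n = 2 * sum (t n) ?T"
    proof -
      have "sum (t n) ?T = (\<Sum>k\<le>m. \<Sum>i\<le>k. B $ i * B' $ (k - i) * phi ?c (s + s' + real (i + (k - i))) n)"
        unfolding t_def by (rule sum.triangle_reindex_eq)
      then show ?thesis
        by (simp add: phi_sum_def fps_mult_nth atLeast0AtMost sum_distrib_right)
    qed
    ultimately show ?thesis using sub by (simp add: sum_diff)
  qed
  show "(\<lambda>n. even_convolution u v n - phi_sum ?c (s + s') (B * B') m n) \<in> ?O"
    unfolding eq by (intro sum_in_bigo(1) 1 2 3 4)
qed

section \<open>The factorial series of the walk numbers\<close>

text \<open>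
  The Taylor coefficients of \<open>(1 - t)\<^bsup>-1/2\<^esup>\<close>.
\<close>

definition inv_sqrt_coeff :: "nat \<Rightarrow> real" where
  "inv_sqrt_coeff k = pochhammer (1 / 2) k / fact k"

lemma inv_sqrt_coeff_pos: "inv_sqrt_coeff k > 0"
  by (auto simp: inv_sqrt_coeff_def intro!: divide_pos_pos pochhammer_pos)

lemma inv_sqrt_coeff_antimono: "i \<le> j \<Longrightarrow> inv_sqrt_coeff j \<le> inv_sqrt_coeff i"
proof (induction rule: dec_induct)
  case (step k)
  have "inv_sqrt_coeff (Suc k) = inv_sqrt_coeff k * ((1 / 2 + real k) / (real k + 1))"
    by (simp add: inv_sqrt_coeff_def pochhammer_Suc field_simps)
  also have "\<dots> \<le> inv_sqrt_coeff k * 1"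
    using inv_sqrt_coeff_pos[of k] by (intro mult_left_mono) auto
  finally show ?case using step by simp
qed simp

lemma inv_sqrt_series:
  assumes "0 \<le> t" "t < 1"
  shows "(\<lambda>k. inv_sqrt_coeff k * t ^ k) sums (1 - t) powr (- 1 / 2)"
proof -
  have "(\<lambda>k. ((- 1 / 2) gchoose k) * (- t) ^ k) sums (1 + - t) powr (- 1 / 2)"
    using assms by (intro gen_binomial_real) auto
  moreover have "((- 1 / 2) gchoose k) * (- t) ^ k = inv_sqrt_coeff k * t ^ k" for k
    by (simp add: gbinomial_pochhammer inv_sqrt_coeff_def uminus_power_if)
  ultimately show ?thesis by simp
qed

text \<open>
  As the coefficients decrease, the tail of the series is at most \<open>t\<^bsup>m+1\<^esup>\<close> times the whole series. The
  bound is valid up to the singularity \<open>t = 1\<close>, so it can be integrated there.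
\<close>

lemma inv_sqrt_tail:
  assumes "0 \<le> t" "t < 1"
  shows "0 \<le> (1 - t) powr (- 1 / 2) - (\<Sum>k\<le>m. inv_sqrt_coeff k * t ^ k)"
    and "(1 - t) powr (- 1 / 2) - (\<Sum>k\<le>m. inv_sqrt_coeff k * t ^ k) \<le> t ^ Suc m * (1 - t) powr (- 1 / 2)"
proof -
  note S = inv_sqrt_series[OF assms]
  have tail: "(\<lambda>k. inv_sqrt_coeff (k + Suc m) * t ^ (k + Suc m)) sums
      ((1 - t) powr (- 1 / 2) - (\<Sum>k\<le>m. inv_sqrt_coeff k * t ^ k))"
    using sums_split_initial_segment[OF S, of "Suc m"] by (simp add: lessThan_Suc_atMost)
  show "0 \<le> (1 - t) powr (- 1 / 2) - (\<Sum>k\<le>m. inv_sqrt_coeff k * t ^ k)"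
    using assms by (intro sums_le[OF _ sums_zero tail]) (auto intro!: mult_nonneg_nonneg less_imp_le[OF inv_sqrt_coeff_pos])
  show "(1 - t) powr (- 1 / 2) - (\<Sum>k\<le>m. inv_sqrt_coeff k * t ^ k) \<le> t ^ Suc m * (1 - t) powr (- 1 / 2)"
  proof (rule sums_le[OF _ tail sums_mult[OF S]])
    fix k
    have "inv_sqrt_coeff (k + Suc m) * t ^ (k + Suc m) \<le> inv_sqrt_coeff k * t ^ (k + Suc m)"
      using assms by (intro mult_right_mono inv_sqrt_coeff_antimono) auto
    also have "\<dots> = t ^ Suc m * (inv_sqrt_coeff k * t ^ k)" by (simp add: power_add)
    finally show "inv_sqrt_coeff (k + Suc m) * t ^ (k + Suc m) \<le> t ^ Suc m * (inv_sqrt_coeff k * t ^ k)" .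
  qed
qed

lemma Gamma_half_plus_nat: "Gamma (real k + 1 / 2) = sqrt pi * pochhammer (1 / 2) k"
proof -
  have "(1 / 2 :: real) \<notin> \<int>\<^sub>\<le>\<^sub>0" by (auto elim!: nonpos_Ints_cases)
  from pochhammer_Gamma[OF this, of k] show ?thesis
    by (simp add: Gamma_one_half_real add_ac)
qed

text \<open>
  Integration by parts of \<open>(1 - y)\<^bsup>2n+1\<^esup> \<surd>(y (2 - y))\<close> gives the recursion
  \<open>(2n + 2) M\<^sub>n\<^sub>+\<^sub>1 = (2n + 1) M\<^sub>n\<close> of the central binomial coefficients.
\<close>

lemma arcsine_moment:
  "((\<lambda>y. (1 - y) ^ (2 * n) / sqrt (y * (2 - y))) has_integral pi / 2 * real ((2 * n) choose n) / 4 ^ n) {0..1::real}"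
proof (induction n)
  case 0
  have "((\<lambda>y. 1 / sqrt (y * (2 - y))) has_integral (- arcsin (1 - 1) - - arcsin (1 - 0))) {0..1::real}"
  proof (rule fundamental_theorem_of_calculus_interior)
    show "continuous_on {0..1::real} (\<lambda>y. - arcsin (1 - y))"
      by (intro continuous_intros) auto
    fix y :: real assume y: "y \<in> {0<..<1}"
    have *: "1 - (1 - y)\<^sup>2 = y * (2 - y)" by (simp add: power2_eq_square algebra_simps)
    have "((\<lambda>y. - arcsin (1 - y)) has_real_derivative 1 / sqrt (y * (2 - y))) (at y)"
      unfolding *[symmetric] using y by (auto intro!: derivative_eq_intros simp: field_simps)
    then show "((\<lambda>y. - arcsin (1 - y)) has_vector_derivative 1 / sqrt (y * (2 - y))) (at y)"
      by (simp add: has_real_derivative_iff_has_vector_derivative)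
  qed simp
  then show ?case by simp
next
  case (Suc n)
  let ?N = "real (2 * n)" and ?s = "\<lambda>y::real. sqrt (y * (2 - y))"
  let ?F = "\<lambda>y. (1 - y) ^ Suc (2 * n) * ?s y"
  let ?F' = "\<lambda>y. (?N + 2) * ((1 - y) ^ (2 * Suc n) / ?s y) - (?N + 1) * ((1 - y) ^ (2 * n) / ?s y)"
  have "(?F' has_integral (?F 1 - ?F 0)) {0..1}"
  proof (rule fundamental_theorem_of_calculus_interior)
    show "continuous_on {0..1::real} ?F" by (intro continuous_intros)
    fix y :: real assume y: "y \<in> {0<..<1}"
    then have pos: "y * (2 - y) > 0" by simp
    have "((\<lambda>y. 1 - y) has_real_derivative - 1) (at y)"
      by (auto intro!: derivative_eq_intros)
    from DERIV_power_Suc[OF this, of "2 * n"]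
    have d1: "((\<lambda>y. (1 - y) ^ Suc (2 * n)) has_real_derivative - (?N + 1) * (1 - y) ^ (2 * n)) (at y)"
      by (simp add: algebra_simps)
    have "((\<lambda>y. y * (2 - y)) has_real_derivative 2 - 2 * y) (at y)"
      by (auto intro!: derivative_eq_intros)
    from DERIV_chain2[OF DERIV_real_sqrt[OF pos] this]
    have "(?s has_real_derivative ((2 - 2 * y) / (2 * ?s y))) (at y)"
      by (simp add: field_simps)
    from DERIV_mult[OF d1 this]
    have d: "(?F has_real_derivative
        - (?N + 1) * (1 - y) ^ (2 * n) * ?s y + (1 - y) ^ Suc (2 * n) * ((2 - 2 * y) / (2 * ?s y))) (at y)"
      by (simp add: mult_ac add_ac)
    have "- (?N + 1) * (1 - y) ^ (2 * n) * ?s y + (1 - y) ^ Suc (2 * n) * ((2 - 2 * y) / (2 * ?s y)) =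
        (- (?N + 1) * (1 - y) ^ (2 * n) * (?s y * ?s y) + (1 - y) ^ (2 * n) * (1 - y) * (1 - y)) / ?s y"
    proof -
      have s: "?s y \<noteq> 0" using pos y by simp
      have "(1 - y) ^ Suc (2 * n) * ((2 - 2 * y) / (2 * ?s y)) = (1 - y) ^ (2 * n) * (1 - y) * (1 - y) / ?s y"
        using s by (simp add: divide_simps)
      moreover have "- (?N + 1) * (1 - y) ^ (2 * n) * ?s y = - (?N + 1) * (1 - y) ^ (2 * n) * (?s y * ?s y) / ?s y"
        using s by (simp only: mult.assoc[symmetric] nonzero_mult_div_cancel_right not_False_eq_True)
      ultimately show ?thesis by (simp only: add_divide_distrib)
    qed
    also have "?s y * ?s y = 1 - (1 - y) * (1 - y)"
      using pos by (simp add: algebra_simps)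
    also have "(- (?N + 1) * (1 - y) ^ (2 * n) * (1 - (1 - y) * (1 - y)) + (1 - y) ^ (2 * n) * (1 - y) * (1 - y)) / ?s y = ?F' y"
    proof -
      have "?F' y = ((?N + 2) * (1 - y) ^ (2 * Suc n) - (?N + 1) * (1 - y) ^ (2 * n)) / ?s y"
        by (simp only: diff_divide_distrib times_divide_eq_right)
      also have "(1 - y) ^ (2 * Suc n) = (1 - y) ^ (2 * n) * (1 - y) * (1 - y)" by simp
      finally show ?thesis by (simp add: algebra_simps)
    qed
    finally show "(?F has_vector_derivative ?F' y) (at y)"
      using d by (simp add: has_real_derivative_iff_has_vector_derivative)
  qed simp
  then have "(?F' has_integral 0) {0..1}" by simp
  from has_integral_add[OF this has_integral_mult_right[OF Suc.IH, of "?N + 1"]]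
  have "((\<lambda>y. (?N + 2) * ((1 - y) ^ (2 * Suc n) / ?s y)) has_integral
      (?N + 1) * (pi / 2 * real ((2 * n) choose n) / 4 ^ n)) {0..1}"
    by simp
  from has_integral_mult_right[OF this, of "1 / (?N + 2)"]
  have "((\<lambda>y. (1 - y) ^ (2 * Suc n) / ?s y) has_integral
      (?N + 1) / (?N + 2) * (pi / 2 * real ((2 * n) choose n) / 4 ^ n)) {0..1}"
    by simp
  also have "(?N + 1) / (?N + 2) * (pi / 2 * real ((2 * n) choose n) / 4 ^ n) =
      pi / 2 * real ((2 * Suc n) choose Suc n) / 4 ^ Suc n"
  proof -
    have c: "real ((2 * Suc n) choose Suc n) = real ((2 * n) choose n) * (4 * ((?N + 1) / (?N + 2)))"
    proof -
      have b: "real ((2 * k) choose k) = fact (2 * k) / (fact k * fact k)" for k :: nat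
        using binomial_fact[of k "2 * k", where 'a = real] by simp
      have "2 * Suc n = Suc (Suc (2 * n))" by simp
      then have 1: "fact (2 * Suc n) = (?N + 2) * (?N + 1) * fact (2 * n)"
        by (simp only: fact_Suc of_nat_Suc) (simp add: algebra_simps)
      have 2: "fact (Suc n) = ((?N + 2) / 2) * (fact n :: real)"
        by (simp only: fact_Suc of_nat_Suc) (simp add: algebra_simps)
      have "?N + 2 \<noteq> 0" "(fact n :: real) \<noteq> 0" by auto
      then show ?thesis unfolding b 1 2 by (simp only: divide_simps) simp
    qed
    have "x * (pi / 2 * b / p) = pi / 2 * (b * (4 * x)) / (4 * p)" for x b p :: real by simp
    then show ?thesis unfolding c power_Suc .
  qed
  finally show ?case .
qed

text \<open>
  The coefficients of the large-\<open>t\<close> expansion \<open>I\<^sub>0(2t) ~ e\<^bsup>2t\<^esup> (4 \<pi> t)\<^bsup>-1/2\<^esup> \<Sum>\<^sub>k b\<^sub>k t\<^bsup>-k\<^esup>\<close> of the Bessel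
  function.
\<close>

definition line_fps :: "real fps" where
  "line_fps = Abs_fps (\<lambda>k. inv_sqrt_coeff k * pochhammer (1 / 2) k / 4 ^ k)"

lemma phi_2: "phi 2 s n = 2 ^ n * 2 powr s * phi 1 s n"
  by (simp add: phi_def powr_add powr_realpow)

text \<open>
  Apart from normalisation, the arcsine density is \<open>(2y)\<^bsup>-1/2\<^esup> (1 - y/2)\<^bsup>-1/2\<^esup>\<close> in the distance \<open>y\<close> from the
  end of the support. On \<open>[0, 1]\<close> the second factor stays below \<open>\<surd>2\<close>, so its Taylor remainder is
  controlled uniformly.
\<close>

lemma arcsine_density_tail:
  fixes y :: real
  assumes "0 \<le> y" "y \<le> 1"
  defines "R \<equiv> \<lambda>m. 1 / sqrt (y * (2 - y)) - (\<Sum>k\<le>m. inv_sqrt_coeff k / 2 ^ k / sqrt 2 * y powr (real k + 1 / 2 - 1))"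
  shows "0 \<le> R m" and "R m \<le> 1 / 2 ^ Suc m * y powr (real m + 3 / 2 - 1)"
proof -
  have "0 \<le> R m \<and> R m \<le> 1 / 2 ^ Suc m * y powr (real m + 3 / 2 - 1)"
  proof (cases "y = 0")
    case False
    with assms have y: "0 < y" "y \<le> 1" by auto
    define T where "T = (1 - y / 2) powr (- 1 / 2) - (\<Sum>k\<le>m. inv_sqrt_coeff k * (y / 2) ^ k)"
    define w where "w = y powr (- 1 / 2) / sqrt 2"
    have w: "w \<ge> 0" by (simp add: w_def)
    have "y * (2 - y) = y * 2 * (1 - y / 2)" by (simp add: algebra_simps)
    then have "sqrt (y * (2 - y)) = sqrt y * sqrt 2 * sqrt (1 - y / 2)"
      by (simp only: real_sqrt_mult)
    then have 1: "1 / sqrt (y * (2 - y)) = w * (1 - y / 2) powr (- 1 / 2)"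
      using y by (simp add: w_def powr_minus_divide powr_half_sqrt)
    have p: "y powr (real k + 1 / 2 - 1) = y ^ k * y powr (- 1 / 2)" for k
      using y powr_add[of y "real k" "- 1 / 2"] by (simp add: powr_realpow)
    have R_eq: "R m = w * T"
      unfolding R_def 1 T_def right_diff_distrib[of w] sum_distrib_left p
      by (intro arg_cong2[of _ _ _ _ minus] sum.cong refl) (simp add: w_def power_divide mult_ac)
    have "(1 - y / 2) powr (- 1 / 2) \<le> (1 / 2) powr (- 1 / 2)"
      using y by (intro powr_mono2') auto
    also have "\<dots> = inverse ((1 / 2) powr (1 / 2))"
      using powr_minus[of "1 / 2 :: real" "1 / 2"] by (simp only: minus_divide_left)
    also have "\<dots> = sqrt 2"
      by (simp only: powr_half_sqrt[of "1 / 2"] zero_le_divide_1_iff zero_le_numeral real_sqrt_divide) simp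
    finally have le: "(1 - y / 2) powr (- 1 / 2) \<le> sqrt 2" .
    have "T \<le> (y / 2) ^ Suc m * (1 - y / 2) powr (- 1 / 2)"
      unfolding T_def using y by (intro inv_sqrt_tail) auto
    also have "\<dots> \<le> (y / 2) ^ Suc m * sqrt 2"
      using y le by (intro mult_left_mono) auto
    finally have T: "T \<le> (y / 2) ^ Suc m * sqrt 2" .
    have "0 \<le> T" unfolding T_def using y by (intro inv_sqrt_tail) auto
    then have "0 \<le> R m" unfolding R_eq using w by simp
    moreover have "w * T \<le> w * ((y / 2) ^ Suc m * sqrt 2)" using T w by (rule mult_left_mono)
    moreover have "w * ((y / 2) ^ Suc m * sqrt 2) = 1 / 2 ^ Suc m * y powr (real m + 3 / 2 - 1)"
      using p[of "Suc m"] by (simp add: w_def power_divide add_ac)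
    ultimately show ?thesis unfolding R_eq by simp
  qed (simp add: R_def)
  then show "0 \<le> R m" and "R m \<le> 1 / 2 ^ Suc m * y powr (real m + 3 / 2 - 1)" by auto
qed

text \<open>
  Integrate the expansion of the arcsine density against \<open>(1 - y)\<^bsup>N\<^esup>\<close>; each power of \<open>y\<close> gives one
  \<open>\<phi>\<close>. Only half of the symmetric arcsine law is used, which for even \<open>N\<close> produces the factor \<open>2\<close> in
  \<open>phi_sum\<close>.
\<close>

lemma line_walks_egf_expands:
  "egf_expands 2 (1 / 2) (fps_const (1 / (2 * sqrt pi)) * line_fps) (\<lambda>n. real (num_closed_walks 1 n) / fact n)"
  unfolding egf_expands_def
proof
  fix m
  define C where "C = 2 / pi * (Gamma (real m + 3 / 2) / 2 ^ Suc m / 2 powr (real m + 3 / 2))"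
  let ?B = "fps_const (1 / (2 * sqrt pi)) * line_fps"
  let ?a = "\<lambda>n. real (num_closed_walks 1 n) / fact n"
  have main: "0 \<le> ?a N - phi_sum 2 (1 / 2) ?B m N \<and> ?a N - phi_sum 2 (1 / 2) ?B m N \<le> C * phi 2 (real m + 3 / 2) N"
    if "even N" for N
  proof -
    obtain n where N: "N = 2 * n" using \<open>even N\<close> by (rule evenE)
    let ?f = "\<lambda>y. (1 - y) ^ N / sqrt (y * (2 - y)) -
      (\<Sum>k\<le>m. inv_sqrt_coeff k / 2 ^ k / sqrt 2 * (y powr (real k + 1 / 2 - 1) * (1 - y) ^ N))"
    define D where "D = pi / 2 * real (N choose n) / 4 ^ n -
      (\<Sum>k\<le>m. inv_sqrt_coeff k / 2 ^ k / sqrt 2 * (Gamma (real k + 1 / 2) * fact N * phi 1 (real k + 1 / 2) N))"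
    have f: "(?f has_integral D) {0..1}"
      unfolding D_def N
      by (intro has_integral_diff arcsine_moment has_integral_sum has_integral_mult_right phi_moment) auto
    have g: "((\<lambda>y. 1 / 2 ^ Suc m * (y powr (real m + 3 / 2 - 1) * (1 - y) ^ N)) has_integral
        1 / 2 ^ Suc m * (Gamma (real m + 3 / 2) * fact N * phi 1 (real m + 3 / 2) N)) {0..1}"
      by (intro has_integral_mult_right phi_moment) auto
    have bounds: "0 \<le> ?f y \<and> ?f y \<le> 1 / 2 ^ Suc m * (y powr (real m + 3 / 2 - 1) * (1 - y) ^ N)"
      if y: "y \<in> {0..1}" for y
    proof -
      define S where "S = (\<Sum>k\<le>m. inv_sqrt_coeff k / 2 ^ k / sqrt 2 * y powr (real k + 1 / 2 - 1))"
      have "?f y = (1 - y) ^ N * (1 / sqrt (y * (2 - y)) - S)"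
        unfolding S_def right_diff_distrib[of "(1 - y) ^ N"] sum_distrib_left
        by (intro arg_cong2[of _ _ _ _ minus] sum.cong refl) simp_all
      moreover have "0 \<le> (1 - y) ^ N * (1 / sqrt (y * (2 - y)) - S)"
        using arcsine_density_tail(1)[of y m] y unfolding S_def by (intro mult_nonneg_nonneg) auto
      moreover have "(1 - y) ^ N * (1 / sqrt (y * (2 - y)) - S) \<le> (1 - y) ^ N * (1 / 2 ^ Suc m * y powr (real m + 3 / 2 - 1))"
        using arcsine_density_tail(2)[of y m] y unfolding S_def by (intro mult_left_mono) auto
      ultimately show ?thesis by (simp only: mult_ac)
    qed
    have "0 \<le> D" using bounds by (intro has_integral_nonneg[OF f]) auto
    moreover have "D \<le> 1 / 2 ^ Suc m * (Gamma (real m + 3 / 2) * fact N * phi 1 (real m + 3 / 2) N)"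
      using bounds by (intro has_integral_le[OF f g]) auto
    moreover have q: "2 / pi * 2 ^ N / fact N > (0::real)" by simp
    ultimately have "0 \<le> 2 / pi * 2 ^ N / fact N * D \<and> 2 / pi * 2 ^ N / fact N * D \<le> 2 / pi * 2 ^ N / fact N *
        (1 / 2 ^ Suc m * (Gamma (real m + 3 / 2) * fact N * phi 1 (real m + 3 / 2) N))"
      by (intro conjI mult_nonneg_nonneg mult_left_mono) auto
    moreover have "2 / pi * 2 ^ N / fact N *
        (1 / 2 ^ Suc m * (Gamma (real m + 3 / 2) * fact N * phi 1 (real m + 3 / 2) N)) = C * phi 2 (real m + 3 / 2) N"
      by (simp add: C_def phi_2)
    moreover have "2 / pi * 2 ^ N / fact N * D = ?a N - phi_sum 2 (1 / 2) ?B m N"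
    proof -
      have "2 / pi * 2 ^ N / fact N * (pi / 2 * real (N choose n) / 4 ^ n) = ?a N"
        using line_walks_return[of n] by (simp add: N num_closed_walks_1[unfolded One_nat_def] power_mult)
      moreover have "2 / pi * 2 ^ N / fact N * (inv_sqrt_coeff k / 2 ^ k / sqrt 2 *
          (Gamma (real k + 1 / 2) * fact N * phi 1 (real k + 1 / 2) N)) = 2 * (?B $ k * phi 2 (1 / 2 + real k) N)" for k
      proof -
        have r: "phi 2 (1 / 2 + real k) N = 2 ^ N * (2 ^ k * sqrt 2) * phi 1 (real k + 1 / 2) N"
          by (simp add: phi_2 powr_add powr_realpow powr_half_sqrt add.commute)
        have "q * q / (p * p) / r / q * p = 1 / p / (r * r) * r * q" if "p \<noteq> 0" "q \<noteq> 0" "r \<noteq> 0" for p q r :: real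
          using that by (simp add: field_simps)
        from this[of "sqrt pi" "sqrt 2" "2 ^ k"]
        have scalar: "2 / pi / 2 ^ k / sqrt 2 * sqrt pi = 1 / sqrt pi / 4 ^ k * 2 ^ k * sqrt 2"
          by (simp flip: power_mult_distrib)
        have "2 / pi * 2 ^ N / fact N * (inv_sqrt_coeff k / 2 ^ k / sqrt 2 *
            (Gamma (real k + 1 / 2) * fact N * phi 1 (real k + 1 / 2) N)) =
          2 ^ N * inv_sqrt_coeff k * pochhammer (1 / 2) k * phi 1 (real k + 1 / 2) N *
            (2 / pi / 2 ^ k / sqrt 2 * sqrt pi)"
          unfolding Gamma_half_plus_nat by (simp add: mult_ac)
        also have "\<dots> = 2 * (?B $ k * phi 2 (1 / 2 + real k) N)"
          unfolding scalar r line_fps_def by simp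
        finally show ?thesis .
      qed
      ultimately show ?thesis
        unfolding D_def right_diff_distrib sum_distrib_left phi_sum_def by simp
    qed
    ultimately show ?thesis by simp
  qed
  have s: "1 / 2 + real (Suc m) = real m + 3 / 2" by simp
  show "(\<lambda>n. ?a n - phi_sum 2 (1 / 2) ?B m n) \<in> O[evens](phi 2 (1 / 2 + real (Suc m)))"
    unfolding s using main
    by (intro bigoI[where c = C]) (auto simp: eventually_principal phi_nonneg)
qed

text \<open>
  Induction on the dimension: one more coordinate is one more convolution, hence one more factor in
  the formal power series.
\<close>

theorem walks_egf_expands:
  assumes "d \<ge> 1"
  shows "egf_expands (2 * real d) (real d / 2) ((fps_const (1 / (2 * sqrt pi)) * line_fps) ^ d)
    (\<lambda>n. real (num_closed_walks d n) / fact n)"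
  using assms
proof (induction rule: dec_induct)
  case base
  then show ?case using line_walks_egf_expands by simp
next
  case (step d)
  let ?a = "\<lambda>d n. real (num_closed_walks d n) / fact n"
  have "egf_expands (2 * real d + 2) (real d / 2 + 1 / 2)
      ((fps_const (1 / (2 * sqrt pi)) * line_fps) ^ d * (fps_const (1 / (2 * sqrt pi)) * line_fps))
      (even_convolution (?a d) (?a 1))"
    using step by (intro egf_expands_convolution line_walks_egf_expands) auto
  moreover have "(even_convolution (?a d) (?a 1) n - P n) = ?a (Suc d) n - P n" if "even n" for n P
  proof -
    have "even_convolution (?a d) (?a 1) n = ?a (Suc d) n"
      unfolding even_convolution_def num_closed_walks_Suc_fact
      using that by (intro sum.cong refl) (auto simp: num_closed_walks_1[unfolded One_nat_def] line_walks_parity)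
    then show ?thesis by simp
  qed
  then have "(\<lambda>n. even_convolution (?a d) (?a 1) n - P n) \<in> O[evens](g) \<longleftrightarrow>
      (\<lambda>n. ?a (Suc d) n - P n) \<in> O[evens](g)" for P g
    by (intro landau_o.big.in_cong) (auto simp: eventually_principal)
  ultimately show ?case
    unfolding egf_expands_def by (simp add: algebra_simps add_divide_distrib)
qed

section \<open>Factorial series as power series\<close>

lemma expands_shifted_inverse:
  "expands (\<lambda>n. 1 / (real n + c)) (fps_X * inverse (1 + fps_const c * fps_X))"
proof -
  have "expands (\<lambda>n. (1 + 1 / real n) - 1) ((1 + fps_const 1 * fps_X) - fps_const 1)"
    by (intro expands_diff expands_one_plus expands_const)
  then have "expands (\<lambda>n. 1 / real n) fps_X" by simp
  then have "expands (\<lambda>n. 1 / real n * (1 / (1 + c / real n))) (fps_X * inverse (1 + fps_const c * fps_X))"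
    by (intro expands_mult expands_inverse expands_one_plus) auto
  then show ?thesis
  proof (rule expands_cong)
    show "\<forall>\<^sub>F n in sequentially. 1 / real n * (1 / (1 + c / real n)) = 1 / (real n + c)"
      using eventually_gt_at_top[of 0]
    proof eventually_elim
      case (elim n)
      then have "real n * (1 + c / real n) = real n + c" by (simp add: field_simps)
      then show ?case by (simp only: times_divide_times_eq mult_1)
    qed
  qed
qed

text \<open>
  The expansion of \<open>1 / ((n + \<sigma>\<^sub>1) \<dots> (n + \<sigma>\<^sub>k))\<close>. It is given as a product of geometric series;
  coefficients are computed by \<open>rising_fps_nth_Suc\<close>.
\<close>

definition rising_fps :: "(nat \<Rightarrow> real) \<Rightarrow> nat \<Rightarrow> real fps" where
  "rising_fps \<sigma> k = (\<Prod>j=1..k. fps_X * inverse (1 + fps_const (\<sigma> j) * fps_X))"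

lemma expands_rising: "expands (\<lambda>n. 1 / (\<Prod>j=1..k. real n + \<sigma> j)) (rising_fps \<sigma> k)"
proof (induction k)
  case 0
  then show ?case using expands_const[of 1] by (simp add: rising_fps_def)
next
  case (Suc k)
  from expands_mult[OF this expands_shifted_inverse[of "\<sigma> (Suc k)"]] show ?case
    by (simp add: rising_fps_def)
qed

lemma rising_fps_nth_0: "rising_fps \<sigma> 0 $ i = (if i = 0 then 1 else 0)"
  "rising_fps \<sigma> (Suc k) $ 0 = 0"
  by (simp_all add: rising_fps_def)

text \<open>
  Compare coefficients in \<open>(1 + \<sigma>\<^sub>k\<^sub>+\<^sub>1 X) R\<^sub>k\<^sub>+\<^sub>1 = X R\<^sub>k\<close>.
\<close>

lemma rising_fps_nth_Suc:
  "rising_fps \<sigma> (Suc k) $ Suc i = rising_fps \<sigma> k $ i - \<sigma> (Suc k) * rising_fps \<sigma> (Suc k) $ i"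
proof -
  let ?L = "1 + fps_const (\<sigma> (Suc k)) * fps_X"
  have "?L * inverse ?L = 1" by (rule inverse_mult_eq_1') simp
  then have "?L * rising_fps \<sigma> (Suc k) = fps_X * rising_fps \<sigma> k"
    by (simp add: rising_fps_def mult_ac)
  then have "(?L * rising_fps \<sigma> (Suc k)) $ Suc i = (fps_X * rising_fps \<sigma> k) $ Suc i" by simp
  then show ?thesis by (simp add: distrib_right mult.assoc)
qed

lemma rising_fps_vanish: "i < k \<Longrightarrow> rising_fps \<sigma> k $ i = 0"
proof (induction k arbitrary: i)
  case (Suc k)
  note outer = Suc.IH
  from Suc.prems show ?case
  proof (induction i)
    case (Suc i)
    then show ?case using outer[of i] by (simp add: rising_fps_nth_Suc)
  qed (simp add: rising_fps_nth_0)
qed simp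

definition factorial_series_fps :: "(nat \<Rightarrow> real) \<Rightarrow> (nat \<Rightarrow> real) \<Rightarrow> real fps" where
  "factorial_series_fps \<sigma> c = Abs_fps (\<lambda>i. \<Sum>k\<le>i. c k * rising_fps \<sigma> k $ i)"

lemma expands_factorial_series:
  assumes "\<And>m. (\<lambda>n. f n - (\<Sum>k\<le>m. c k / (\<Prod>j=1..k. real n + \<sigma> j))) \<in> O(\<lambda>n. 1 / real n ^ Suc m)"
  shows "expands f (factorial_series_fps \<sigma> c)"
proof -
  have "expands f (Abs_fps (\<lambda>i. \<Sum>k\<le>i. (fps_const (c k) * rising_fps \<sigma> k) $ i))"
  proof (rule expands_series)
    show "expands (\<lambda>n. c k * (1 / (\<Prod>j=1..k. real n + \<sigma> j))) (fps_const (c k) * rising_fps \<sigma> k)" for k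
      by (intro expands_mult expands_const expands_rising)
    show "(fps_const (c k) * rising_fps \<sigma> k) $ i = 0" if "i < k" for k i
      using that by (simp add: rising_fps_vanish)
  qed (use assms in simp)
  then show ?thesis by (simp add: factorial_series_fps_def)
qed

lemma factorial_series_fps_nth:
  fixes \<sigma> c :: "nat \<Rightarrow> real"
  defines "F \<equiv> factorial_series_fps \<sigma> c"
  shows "F $ 0 = c 0" "F $ 1 = c 1" "F $ 2 = c 2 - c 1 * \<sigma> 1"
    "F $ 3 = c 3 - c 2 * (\<sigma> 1 + \<sigma> 2) + c 1 * \<sigma> 1 ^ 2"
    "F $ 4 = c 4 - c 3 * (\<sigma> 1 + \<sigma> 2 + \<sigma> 3) + c 2 * (\<sigma> 1 ^ 2 + \<sigma> 1 * \<sigma> 2 + \<sigma> 2 ^ 2) - c 1 * \<sigma> 1 ^ 3"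
  by (simp_all add: F_def factorial_series_fps_def eval_nat_numeral rising_fps_nth_0 rising_fps_nth_Suc algebra_simps)

section \<open>Expansions of Gamma quotients\<close>

text \<open>
  The square of \<open>\<Gamma>(n + 1) / (\<surd>n \<Gamma>(n + 1/2))\<close>. Squaring makes Gauss' summation of the hypergeometric
  series applicable.
\<close>

definition wallis_quotient :: "nat \<Rightarrow> real" where
  "wallis_quotient n = Gamma (real n) * Gamma (real n + 1) / Gamma (real n + 1 / 2) ^ 2"

lemma Gamma_shift_product:
  assumes "x > 0"
  shows "Gamma (x + real k) = Gamma x * (\<Prod>j=1..k. x + real j - 1)"
proof (induction k)
  case (Suc k)
  have "Gamma (x + real (Suc k)) = (x + real k) * Gamma (x + real k)"
    using Gamma_real_plus1[of "x + real k"] assms by (simp add: add_ac)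
  then show ?case using Suc.IH by (simp add: prod.nat_ivl_Suc')
qed simp

text \<open>
  The series is Gauss' \<open>F(1/2, 1/2; n + 1; 1)\<close>. Euler's integral proves it with a remainder: in
  \<open>B(1/2, n) = \<integral> t\<^bsup>-1/2\<^esup> (1 - t)\<^bsup>n-1\<^esup> dt\<close> split off a factor \<open>(1 - t)\<^bsup>-1/2\<^esup>\<close> from the second power and
  expand it.
\<close>

lemma wallis_quotient_bounds:
  fixes m n :: nat
  assumes n: "n \<ge> 1"
  defines "R \<equiv> wallis_quotient n - (\<Sum>k\<le>m. inv_sqrt_coeff k * pochhammer (1 / 2) k / (\<Prod>j=1..k. real n + real j))"
  shows "0 \<le> R" and "R \<le> pochhammer (1 / 2) (Suc m) * wallis_quotient n / real n ^ Suc m"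
proof -
  let ?f = "\<lambda>t. t powr (1 / 2 - 1) * (1 - t) powr (real n - 1) -
    (\<Sum>k\<le>m. inv_sqrt_coeff k * (t powr (real k + 1 / 2 - 1) * (1 - t) powr (real n + 1 / 2 - 1)))"
  define D where "D = Beta (1 / 2) (real n) - (\<Sum>k\<le>m. inv_sqrt_coeff k * Beta (real k + 1 / 2) (real n + 1 / 2))"
  have f: "(?f has_integral D) {0..1}"
    unfolding D_def using n
    by (intro has_integral_diff has_integral_sum has_integral_mult_right has_integral_Beta_real) auto
  have g: "((\<lambda>t. t powr (real m + 3 / 2 - 1) * (1 - t) powr (real n - 1)) has_integral Beta (real m + 3 / 2) (real n)) {0..1}"
    using n by (intro has_integral_Beta_real) auto
  have bounds: "0 \<le> ?f t \<and> ?f t \<le> t powr (real m + 3 / 2 - 1) * (1 - t) powr (real n - 1)"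
    if t: "t \<in> {0..1}" for t
  proof (cases "t = 0 \<or> t = 1")
    case False
    with t have t: "0 < t" "t < 1" by auto
    define T where "T = (1 - t) powr (- 1 / 2) - (\<Sum>k\<le>m. inv_sqrt_coeff k * t ^ k)"
    define w where "w = t powr (- 1 / 2) * (1 - t) powr (real n - 1 / 2)"
    have p: "t powr (real k + 1 / 2 - 1) = t ^ k * t powr (- 1 / 2)" for k
      using t powr_add[of t "real k" "- 1 / 2"] by (simp add: powr_realpow)
    have 1: "t powr (1 / 2 - 1) * (1 - t) powr (real n - 1) = w * (1 - t) powr (- 1 / 2)"
      using t by (simp add: w_def flip: powr_add)
    have f_eq: "?f t = w * T"
      unfolding 1 T_def right_diff_distrib[of w] sum_distrib_left p
      by (intro arg_cong2[of _ _ _ _ minus] sum.cong refl) (simp add: w_def)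
    have T: "0 \<le> T" "T \<le> t ^ Suc m * (1 - t) powr (- 1 / 2)"
      unfolding T_def using t by (intro inv_sqrt_tail; simp)+
    have "w * T \<le> w * (t ^ Suc m * (1 - t) powr (- 1 / 2))"
      using T(2) by (intro mult_left_mono) (auto simp: w_def)
    also have "\<dots> = t ^ Suc m * (t powr (1 / 2 - 1) * (1 - t) powr (real n - 1))"
      unfolding 1 by (simp only: mult_ac)
    also have "\<dots> = t powr (real m + 3 / 2 - 1) * (1 - t) powr (real n - 1)"
    proof -
      have "t powr (real m + 3 / 2 - 1) = t ^ Suc m * t powr (1 / 2 - 1)"
        using p[of "Suc m"] by (simp add: add_ac)
      then show ?thesis by (simp only: mult.assoc)
    qed
    finally show ?thesis unfolding f_eq using T(1) by (simp add: w_def)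
  qed auto
  \<comment> \<open>The factor that turns the Beta function \<open>B(1/2, n)\<close> into the Wallis quotient.\<close>
  define q where "q = Gamma (real n + 1) / (Gamma (real n + 1 / 2) * sqrt pi)"
  have q: "q > 0" by (auto simp: q_def intro!: divide_pos_pos mult_pos_pos)
  have G: "Gamma (real n) > 0" "Gamma (real n + 1) > 0" "Gamma (real n + 1 / 2) > 0" "sqrt pi > 0"
    using n by (auto intro!: Gamma_real_pos)
  have "q * Beta (1 / 2) (real n) = wallis_quotient n"
    using G by (simp add: q_def Beta_def wallis_quotient_def Gamma_one_half_real power2_eq_square add.commute)
  moreover have "q * (inv_sqrt_coeff k * Beta (real k + 1 / 2) (real n + 1 / 2)) =
      inv_sqrt_coeff k * pochhammer (1 / 2) k / (\<Prod>j=1..k. real n + real j)" for k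
  proof -
    have "Gamma (real k + 1 / 2 + (real n + 1 / 2)) = Gamma (real n + 1) * (\<Prod>j=1..k. real n + real j)"
      using Gamma_shift_product[of "real n + 1" k] by (simp add: add_ac)
    moreover have "Gamma (real n + 1) \<noteq> 0" "Gamma (real n + 1 / 2) \<noteq> 0" "sqrt pi \<noteq> 0"
      using G by (metis less_irrefl)+
    ultimately show ?thesis
      unfolding q_def Beta_def Gamma_half_plus_nat[of k] by (simp only: divide_simps) simp
  qed
  ultimately have R: "R = q * D"
    by (simp add: R_def D_def right_diff_distrib sum_distrib_left)
  have "0 \<le> D" using bounds by (intro has_integral_nonneg[OF f]) auto
  then show "0 \<le> R" using q by (simp add: R)
  have "D \<le> Beta (real m + 3 / 2) (real n)" using bounds by (intro has_integral_le[OF f g]) auto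
  then have "R \<le> q * Beta (real m + 3 / 2) (real n)" using q by (simp add: R)
  also have "\<dots> = pochhammer (1 / 2) (Suc m) * wallis_quotient n / (\<Prod>j=1..Suc m. real n + 1 / 2 + real j - 1)"
  proof -
    have "Gamma (real m + 3 / 2 + real n) = Gamma (real n + 1 / 2) * (\<Prod>j=1..Suc m. real n + 1 / 2 + real j - 1)"
      using Gamma_shift_product[of "real n + 1 / 2" "Suc m"] by (simp add: add_ac)
    moreover have "Gamma (real m + 3 / 2) = sqrt pi * pochhammer (1 / 2) (Suc m)"
      using Gamma_half_plus_nat[of "Suc m"] by (simp add: add_ac)
    ultimately show ?thesis
      using G unfolding q_def Beta_def wallis_quotient_def by (simp only: power2_eq_square) (simp add: mult_ac)
  qed
  also have "\<dots> \<le> pochhammer (1 / 2) (Suc m) * wallis_quotient n / real n ^ Suc m"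
  proof (rule divide_left_mono)
    have "(\<Prod>j=1..Suc m. real n) \<le> (\<Prod>j=1..Suc m. real n + 1 / 2 + real j - 1)"
      by (intro prod_mono) auto
    then show le: "real n ^ Suc m \<le> (\<Prod>j=1..Suc m. real n + 1 / 2 + real j - 1)"
      by (simp only: prod_constant) simp
    have "0 < real n ^ Suc m" using n by (intro zero_less_power) auto
    then show "0 < (\<Prod>j=1..Suc m. real n + 1 / 2 + real j - 1) * real n ^ Suc m"
      using le by (intro mult_pos_pos) (rule less_le_trans)
    show "0 \<le> pochhammer (1 / 2) (Suc m) * wallis_quotient n"
      using G by (intro mult_nonneg_nonneg less_imp_le[OF pochhammer_pos]) (auto simp: wallis_quotient_def)
  qed
  finally show "R \<le> pochhammer (1 / 2) (Suc m) * wallis_quotient n / real n ^ Suc m" .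
qed

text \<open>
  The case \<open>m = 0\<close> of the bounds is an inequality for the quotient itself and shows that it is at
  most \<open>2\<close>.
\<close>

lemma wallis_quotient_bigo:
  "(\<lambda>n. wallis_quotient n - (\<Sum>k\<le>m. inv_sqrt_coeff k * pochhammer (1 / 2) k / (\<Prod>j=1..k. real n + real j)))
    \<in> O(\<lambda>n. 1 / real n ^ Suc m)"
proof (rule bigoI[where c = "pochhammer (1 / 2) (Suc m) * 2"])
  have p: "pochhammer (1 / 2) (Suc m) > (0::real)" by (rule pochhammer_pos) simp
  show "\<forall>\<^sub>F n in sequentially. norm (wallis_quotient n -
      (\<Sum>k\<le>m. inv_sqrt_coeff k * pochhammer (1 / 2) k / (\<Prod>j=1..k. real n + real j)))
      \<le> pochhammer (1 / 2) (Suc m) * 2 * norm (1 / real n ^ Suc m)"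
    using eventually_ge_at_top[of 1]
  proof eventually_elim
    case (elim n)
    have "wallis_quotient n - 1 \<le> 1 / 2 * wallis_quotient n / real n"
      using wallis_quotient_bounds(2)[OF elim, of 0] by (simp add: inv_sqrt_coeff_def)
    also have "\<dots> \<le> 1 / 2 * wallis_quotient n"
    proof -
      have "wallis_quotient n \<ge> 0" using elim by (auto simp: wallis_quotient_def)
      then have "wallis_quotient n * 1 \<le> wallis_quotient n * real n"
        using elim by (intro mult_left_mono) auto
      then show ?thesis using elim by (simp add: field_simps)
    qed
    finally have "wallis_quotient n \<le> 2" by simp
    then have "pochhammer (1 / 2) (Suc m) * wallis_quotient n / real n ^ Suc m \<le>
        pochhammer (1 / 2) (Suc m) * 2 / real n ^ Suc m"
      using p by (intro divide_right_mono mult_left_mono) auto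
    with wallis_quotient_bounds[OF elim, of m] show ?case by simp
  qed
qed

lemma fps_mult_nth_small:
  fixes F G :: "real fps"
  shows "(F * G) $ 0 = F $ 0 * G $ 0" "(F * G) $ 1 = F $ 0 * G $ 1 + F $ 1 * G $ 0"
    "(F * G) $ 2 = F $ 0 * G $ 2 + F $ 1 * G $ 1 + F $ 2 * G $ 0"
    "(F * G) $ 3 = F $ 0 * G $ 3 + F $ 1 * G $ 2 + F $ 2 * G $ 1 + F $ 3 * G $ 0"
    "(F * G) $ 4 = F $ 0 * G $ 4 + F $ 1 * G $ 3 + F $ 2 * G $ 2 + F $ 3 * G $ 1 + F $ 4 * G $ 0"
  by (simp_all add: fps_mult_nth eval_nat_numeral)

lemma fps_inverse_nth_small:
  fixes F :: "real fps"
  assumes "F $ 0 = 1"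
  shows "inverse F $ 0 = 1" "inverse F $ 1 = - (F $ 1)" "inverse F $ 2 = (F $ 1) ^ 2 - F $ 2"
    "inverse F $ 3 = 2 * F $ 1 * F $ 2 - (F $ 1) ^ 3 - F $ 3"
    "inverse F $ 4 = (F $ 1) ^ 4 - 3 * (F $ 1) ^ 2 * F $ 2 + 2 * F $ 1 * F $ 3 + (F $ 2) ^ 2 - F $ 4"
proof -
  let ?G = "inverse F"
  have FG: "F * ?G = 1" using assms by (intro inverse_mult_eq_1') simp
  have e: "(F * ?G) $ k = (if k = 0 then 1 else 0)" for k unfolding FG by simp
  show 0: "?G $ 0 = 1" using assms by simp
  show 1: "?G $ 1 = - (F $ 1)" using e[of 1] unfolding fps_mult_nth_small assms 0 by (simp del: One_nat_def)
  show 2: "?G $ 2 = (F $ 1) ^ 2 - F $ 2"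
    using e[of 2] unfolding fps_mult_nth_small assms 0 1 by (simp add: power2_eq_square del: One_nat_def)
  show 3: "?G $ 3 = 2 * F $ 1 * F $ 2 - (F $ 1) ^ 3 - F $ 3"
    using e[of 3] unfolding fps_mult_nth_small assms 0 1 2
    by (simp add: power2_eq_square power3_eq_cube algebra_simps del: One_nat_def)
  show "?G $ 4 = (F $ 1) ^ 4 - 3 * (F $ 1) ^ 2 * F $ 2 + 2 * F $ 1 * F $ 3 + (F $ 2) ^ 2 - F $ 4"
    using e[of 4] unfolding fps_mult_nth_small assms 0 1 2 3
    by (simp add: power2_eq_square power3_eq_cube power4_eq_xxxx algebra_simps del: One_nat_def)
qed

lemma inv_sqrt_coeff_small:
  "inv_sqrt_coeff 0 = 1" "inv_sqrt_coeff 1 = 1 / 2" "inv_sqrt_coeff 2 = 3 / 8"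
  "inv_sqrt_coeff 3 = 5 / 16" "inv_sqrt_coeff 4 = 35 / 128"
  and pochhammer_half_small:
  "pochhammer (1 / 2 :: real) 0 = 1" "pochhammer (1 / 2 :: real) 1 = 1 / 2" "pochhammer (1 / 2 :: real) 2 = 3 / 4"
  "pochhammer (1 / 2 :: real) 3 = 15 / 8" "pochhammer (1 / 2 :: real) 4 = 105 / 16"
  by (simp_all add: inv_sqrt_coeff_def pochhammer_Suc eval_nat_numeral)

definition central_quotient :: "nat \<Rightarrow> real" where
  "central_quotient n = sqrt (real n) * Gamma (real n + 1 / 2) / Gamma (real n + 1)"

text \<open>
  Invert the series of the Wallis quotient and take the square root.
\<close>

lemma central_quotient_expands:
  obtains H where "expands central_quotient H" "H $ 0 = 1" "H $ 1 = - 1 / 8" "H $ 2 = 1 / 128"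
    "H $ 3 = 5 / 1024" "H $ 4 = - 21 / 32768"
proof -
  let ?c = "\<lambda>k. inv_sqrt_coeff k * pochhammer (1 / 2) k"
  define W where "W = factorial_series_fps real ?c"
  have W: "expands wallis_quotient W"
    unfolding W_def using wallis_quotient_bigo by (intro expands_factorial_series) simp
  have W_nth: "W $ 0 = 1" "W $ 1 = 1 / 4" "W $ 2 = 1 / 32" "W $ 3 = - 1 / 128" "W $ 4 = - 5 / 2048"
    unfolding W_def factorial_series_fps_nth inv_sqrt_coeff_small pochhammer_half_small
    by (simp_all add: eval_nat_numeral)
  define V where "V = inverse W"
  have V_nth: "V $ 0 = 1" "V $ 1 = - 1 / 4" "V $ 2 = 1 / 32" "V $ 3 = 1 / 128" "V $ 4 = - 5 / 2048"
    unfolding V_def fps_inverse_nth_small[OF W_nth(1)] W_nth by (simp_all add: power_divide)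
  \<comment> \<open>The formal square root with constant term 1.\<close>
  define H where "H = fps_radical (\<lambda>k x. root k x) (Suc 1) V"
  have HH: "H * H = V"
    using power_radical[of V "\<lambda>k x. root k x" 1] V_nth(1) by (simp add: H_def power2_eq_square numeral_2_eq_2)
  have H0: "H $ 0 = 1" by (simp add: H_def V_nth)
  have e: "(H * H) $ k = V $ k" for k by (simp add: HH)
  have H1: "H $ 1 = - 1 / 8" using e[of 1] unfolding fps_mult_nth_small H0 V_nth by simp
  have H2: "H $ 2 = 1 / 128" using e[of 2] unfolding fps_mult_nth_small H0 H1 V_nth by simp
  have H3: "H $ 3 = 5 / 1024" using e[of 3] unfolding fps_mult_nth_small H0 H1 H2 V_nth by simp
  have H4: "H $ 4 = - 21 / 32768" using e[of 4] unfolding fps_mult_nth_small H0 H1 H2 H3 V_nth by simp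
  have "expands (\<lambda>n. sqrt (1 / wallis_quotient n)) H"
  proof (rule expands_sqrt)
    show "expands (\<lambda>n. 1 / wallis_quotient n) (H * H)"
      unfolding HH V_def using W W_nth by (intro expands_inverse) auto
    have "wallis_quotient n \<ge> 0" for n
      by (cases "n = 0") (auto simp: wallis_quotient_def)
    then show "1 / wallis_quotient n \<ge> 0" for n by simp
  qed (simp add: H0)
  moreover have "\<forall>\<^sub>F n in sequentially. sqrt (1 / wallis_quotient n) = central_quotient n"
    using eventually_gt_at_top[of 0]
  proof eventually_elim
    case (elim n)
    have G: "Gamma (real n) > 0" "Gamma (real n + 1 / 2) > 0" "Gamma (real n + 1) > 0" using elim by auto
    have g: "Gamma (real n + 1) = real n * Gamma (real n)" using elim by (intro Gamma_real_plus1) simp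
    have "sqrt (real n) ^ 2 = real n" by simp
    then have "central_quotient n ^ 2 = real n * Gamma (real n + 1 / 2) ^ 2 / Gamma (real n + 1) ^ 2"
      by (simp only: central_quotient_def power_divide power_mult_distrib)
    also have "\<dots> = 1 / wallis_quotient n"
      unfolding g wallis_quotient_def using elim G(1) by (simp add: power2_eq_square)
    finally have "sqrt (1 / wallis_quotient n) = sqrt (central_quotient n ^ 2)" by simp
    then show ?case using G by (simp add: central_quotient_def)
  qed
  ultimately have "expands central_quotient H" by (rule expands_cong)
  with H0 H1 H2 H3 H4 show ?thesis using that by blast
qed

lemma central_quotient_choose:
  assumes "n \<ge> 1"
  shows "real ((2 * n) choose n) = 4 ^ n * central_quotient n / sqrt (pi * real n)"
proof -
  have "real ((2 * n) choose n) = fact (2 * n) / (fact n * fact n)"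
    using binomial_fact[of n "2 * n", where 'a = real] by simp
  also have "fact (2 * n) = 4 ^ n * pochhammer (1 / 2) n * (fact n :: real)"
    using fact_double[of n, where 'a = real] by (simp add: power_mult[of 2 2])
  also have "4 ^ n * pochhammer (1 / 2) n * fact n / (fact n * fact n) = 4 ^ n * pochhammer (1 / 2) n / (fact n :: real)"
    by simp
  also have "\<dots> = 4 ^ n * central_quotient n / sqrt (pi * real n)"
  proof -
    have "fact n = Gamma (real n + 1)" by (simp add: Gamma_fact add.commute)
    then show ?thesis
      using assms unfolding central_quotient_def Gamma_half_plus_nat by (simp add: real_sqrt_mult)
  qed
  finally show ?thesis .
qed

definition gamma_quotient :: "real \<Rightarrow> nat \<Rightarrow> real" where
  "gamma_quotient s n = (2 * real n) powr s * Gamma (real (2 * n) + 1) / Gamma (real (2 * n) + 1 + s)"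

lemma gamma_quotient_plus1:
  assumes "s \<ge> 0" "n \<ge> 1"
  shows "gamma_quotient (s + 1) n = gamma_quotient s n * (1 / (1 + ((s + 1) / 2) / real n))"
proof -
  have "Gamma (real (2 * n) + 1 + s + 1) = (real (2 * n) + 1 + s) * Gamma (real (2 * n) + 1 + s)"
    using assms by (intro Gamma_real_plus1) auto
  moreover have "(2 * real n) powr (s + 1) = (2 * real n) powr s * (2 * real n)"
    using assms by (simp add: powr_add)
  moreover have "1 / (1 + ((s + 1) / 2) / real n) = 2 * real n / (real (2 * n) + 1 + s)"
    using assms by (simp add: field_simps)
  ultimately show ?thesis by (simp add: gamma_quotient_def add_ac mult_ac)
qed

text \<open>
  At \<open>s = 1/2\<close> the Gamma quotient is a rational function times the reciprocal of the central quotient,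
  taken at \<open>2n\<close> because this is the length of the walks.
\<close>

lemma gamma_quotient_half:
  assumes "n \<ge> 1"
  shows "gamma_quotient (1 / 2) n = 1 / (1 + (1 / 4) / real n) * (1 / central_quotient (2 * n))"
proof -
  have "Gamma (real (2 * n) + 1 / 2 + 1) = (real (2 * n) + 1 / 2) * Gamma (real (2 * n) + 1 / 2)"
    by (intro Gamma_real_plus1) auto
  then have "gamma_quotient (1 / 2) n =
      sqrt (2 * real n) * Gamma (real (2 * n) + 1) / ((real (2 * n) + 1 / 2) * Gamma (real (2 * n) + 1 / 2))"
    by (simp add: gamma_quotient_def powr_half_sqrt add_ac)
  also have "sqrt (2 * real n) = 2 * real n / sqrt (2 * real n)"
    by (rule real_div_sqrt[symmetric]) simp
  also have "2 * real n / sqrt (2 * real n) * Gamma (real (2 * n) + 1) / ((real (2 * n) + 1 / 2) * Gamma (real (2 * n) + 1 / 2)) =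
      2 * real n / (real (2 * n) + 1 / 2) * (1 / central_quotient (2 * n))"
    by (simp add: central_quotient_def mult_ac)
  also have "2 * real n / (real (2 * n) + 1 / 2) = 1 / (1 + (1 / 4) / real n)"
    using assms by (simp add: field_simps)
  finally show ?thesis .
qed

text \<open>
  The coefficients of the classical expansion of \<open>z\<^sup>s \<Gamma>(z + 1) / \<Gamma>(z + 1 + s)\<close> at \<open>z = 2n\<close>. The
  polynomials are determined by the recursion in \<open>gamma_quotient_series_plus1\<close>; they can be found by
  interpolation at natural numbers \<open>s\<close>, where the quotient is a rational function of \<open>n\<close>.
\<close>

definition gamma_quotient_series :: "real \<Rightarrow> real fps \<Rightarrow> bool" where
  "gamma_quotient_series s F \<longleftrightarrow> expands (gamma_quotient s) F \<and> F $ 0 = 1 \<and>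
     F $ 1 = - (s + s ^ 2) / 4 \<and>
     F $ 2 = (2 * s + 9 * s ^ 2 + 10 * s ^ 3 + 3 * s ^ 4) / 96 \<and>
     F $ 3 = - (6 * s ^ 2 + 17 * s ^ 3 + 17 * s ^ 4 + 7 * s ^ 5 + s ^ 6) / 384 \<and>
     F $ 4 = (- 48 * s + 20 * s ^ 2 + 900 * s ^ 3 + 2015 * s ^ 4 + 1848 * s ^ 5 + 830 * s ^ 6
       + 180 * s ^ 7 + 15 * s ^ 8) / 92160"

lemma linear_fps_nth:
  fixes c :: real
  shows "(1 + fps_const c * fps_X) $ 0 = 1" "(1 + fps_const c * fps_X) $ 1 = c"
    "(1 + fps_const c * fps_X) $ 2 = 0" "(1 + fps_const c * fps_X) $ 3 = 0" "(1 + fps_const c * fps_X) $ 4 = 0"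
  by (simp_all add: fps_X_def)

lemma gamma_quotient_series_plus1:
  assumes "s \<ge> 0" and F: "gamma_quotient_series s F"
  shows "gamma_quotient_series (s + 1) (F * inverse (1 + fps_const ((s + 1) / 2) * fps_X))"
proof -
  let ?L = "1 + fps_const ((s + 1) / 2) * fps_X"
  have "expands (\<lambda>n. gamma_quotient s n * (1 / (1 + ((s + 1) / 2) / real n))) (F * inverse ?L)"
    using F by (intro expands_mult expands_inverse expands_one_plus) (auto simp: gamma_quotient_series_def)
  then have ex: "expands (gamma_quotient (s + 1)) (F * inverse ?L)"
  proof (rule expands_cong)
    show "\<forall>\<^sub>F n in sequentially. gamma_quotient s n * (1 / (1 + ((s + 1) / 2) / real n)) = gamma_quotient (s + 1) n"
      using eventually_ge_at_top[of 1]
      by eventually_elim (rule gamma_quotient_plus1[OF assms(1), symmetric])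
  qed
  have F_nth: "F $ 0 = 1" "F $ 1 = - (s + s ^ 2) / 4"
     "F $ 2 = (2 * s + 9 * s ^ 2 + 10 * s ^ 3 + 3 * s ^ 4) / 96"
     "F $ 3 = - (6 * s ^ 2 + 17 * s ^ 3 + 17 * s ^ 4 + 7 * s ^ 5 + s ^ 6) / 384"
     "F $ 4 = (- 48 * s + 20 * s ^ 2 + 900 * s ^ 3 + 2015 * s ^ 4 + 1848 * s ^ 5 + 830 * s ^ 6
       + 180 * s ^ 7 + 15 * s ^ 8) / 92160"
    using F by (auto simp: gamma_quotient_series_def)
  show ?thesis
    unfolding gamma_quotient_series_def fps_mult_nth_small fps_inverse_nth_small[OF linear_fps_nth(1)]
      linear_fps_nth F_nth
    by (intro conjI ex; simp add: field_simps eval_nat_numeral)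
qed

text \<open>
  Steps of size one in \<open>s\<close> are steps of size two in the dimension, so both \<open>d = 0\<close> and \<open>d = 1\<close> are
  needed to start.
\<close>

lemma gamma_quotient_series_exists: "\<exists>F. gamma_quotient_series (real d / 2) F"
proof (induction d rule: induct_nat_012)
  case 0
  have "expands (gamma_quotient 0) (fps_const 1)"
    using expands_const
  proof (rule expands_cong)
    show "\<forall>\<^sub>F n in sequentially. 1 = gamma_quotient 0 n"
      using eventually_ge_at_top[of 1] 
    proof eventually_elim
      case (elim n)
      have "Gamma (2 * real n + 1) > 0" by (intro Gamma_real_pos) auto
      then have "Gamma (2 * real n + 1) \<noteq> 0" by (metis less_irrefl)
      with elim show ?case by (simp add: gamma_quotient_def)
    qed
  qed
  then show ?case by (intro exI[of _ "fps_const 1"]) (simp add: gamma_quotient_series_def)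
next
  case 1
  obtain H where H: "expands central_quotient H" "H $ 0 = 1" "H $ 1 = - 1 / 8" "H $ 2 = 1 / 128"
    "H $ 3 = 5 / 1024" "H $ 4 = - 21 / 32768"
    by (rule central_quotient_expands)
  define K where "K = Abs_fps (\<lambda>k. H $ k / 2 ^ k)"
  have K_nth: "K $ 0 = 1" "K $ 1 = - 1 / 16" "K $ 2 = 1 / 512" "K $ 3 = 5 / 8192" "K $ 4 = - 21 / 524288"
    by (simp_all add: K_def H del: One_nat_def)
  let ?L = "1 + fps_const (1 / 4) * fps_X" let ?F = "inverse ?L * inverse K"
  have "expands (\<lambda>n. 1 / (1 + (1 / 4) / real n) * (1 / central_quotient (2 * n))) ?F"
    using K_nth(1) unfolding K_def
    by (intro expands_mult expands_inverse expands_one_plus expands_double H) auto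
  then have "expands (gamma_quotient (1 / 2)) ?F"
  proof (rule expands_cong)
    show "\<forall>\<^sub>F n in sequentially. 1 / (1 + (1 / 4) / real n) * (1 / central_quotient (2 * n)) = gamma_quotient (1 / 2) n"
      using eventually_ge_at_top[of 1] by eventually_elim (rule gamma_quotient_half[symmetric])
  qed
  then have "gamma_quotient_series (1 / 2) ?F"
    unfolding gamma_quotient_series_def fps_mult_nth_small fps_inverse_nth_small[OF linear_fps_nth(1)]
      linear_fps_nth fps_inverse_nth_small[OF K_nth(1)] K_nth
    by (simp add: power_divide eval_nat_numeral)
  then show ?case by auto
next
  case (ge2 d)
  then obtain F where "gamma_quotient_series (real d / 2) F" by blast
  from gamma_quotient_series_plus1[OF _ this]
  have "\<exists>F. gamma_quotient_series (real d / 2 + 1) F" by auto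
  also have "real d / 2 + 1 = real (Suc (Suc d)) / 2" by simp
  finally show ?case .
qed

section \<open>The expansion of the walk numbers\<close>

text \<open>
  The bracket in the asymptotic formula for the number of walks.
\<close>

definition walk_quotient :: "nat \<Rightarrow> nat \<Rightarrow> real" where
  "walk_quotient d n = real (num_closed_walks d (2 * n)) /
     (lead_const d * ((2 * real d) ^ (2 * n) / (pi * real n) powr (real d / 2)))"

text \<open>
  The number of walks relative to the first term of its factorial series.
\<close>

definition reduced_quotient :: "nat \<Rightarrow> nat \<Rightarrow> real" where
  "reduced_quotient d n = real (num_closed_walks d (2 * n)) / fact (2 * n) /
     (2 * (1 / (2 * sqrt pi)) ^ d * phi (2 * real d) (real d / 2) (2 * n))"

lemma phi_add_product:
  assumes "c > 0" "s \<ge> 0"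
  shows "phi c (s + real k) n = phi c s n * (c ^ k / (\<Prod>j=1..k. real n + s + real j))"
proof (induction k)
  case (Suc k)
  have "phi c (s + real (Suc k)) n = phi c (s + real k) n * (c / (real n + s + real (Suc k)))"
    using phi_plus1[of c "s + real k" n] assms by (simp add: add_ac)
  then show ?case by (simp add: Suc.IH mult_ac)
qed simp

text \<open>
  The factors \<open>2\<close> from \<open>c = 2d\<close> and from the index \<open>2n\<close> cancel, so that the ratio is a rational
  function of \<open>n\<close> as in \<open>rising_fps\<close>.
\<close>

lemma phi_ratio_double:
  assumes "d \<ge> 1"
  shows "phi (2 * real d) (real d / 2 + real k) (2 * n) / phi (2 * real d) (real d / 2) (2 * n) =
    real d ^ k / (\<Prod>j=1..k. real n + (real d / 2 + real j) / 2)"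
proof -
  let ?s = "real d / 2"
  have "(\<Prod>j=1..k. real (2 * n) + ?s + real j) = (\<Prod>j=1..k. 2 * (real n + (?s + real j) / 2))"
    by (intro prod.cong refl) simp
  also have "\<dots> = 2 ^ k * (\<Prod>j=1..k. real n + (?s + real j) / 2)"
    by (simp only: prod.distrib prod_constant) simp
  finally have "phi (2 * real d) (?s + real k) (2 * n) = phi (2 * real d) ?s (2 * n) *
      ((2 * real d) ^ k / (2 ^ k * (\<Prod>j=1..k. real n + (?s + real j) / 2)))"
    using assms by (subst phi_add_product) auto
  moreover have "phi (2 * real d) ?s (2 * n) \<noteq> 0"
    using phi_pos[of "2 * real d" ?s "2 * n"] assms by simp
  ultimately show ?thesis
    by (simp add: power_mult_distrib)
qed

lemma reduced_quotient_expands: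
  assumes "d \<ge> 1"
  shows "expands (reduced_quotient d)
    (factorial_series_fps (\<lambda>j. (real d / 2 + real j) / 2) (\<lambda>k. (line_fps ^ d) $ k * real d ^ k))"
proof (rule expands_factorial_series)
  fix m
  let ?s = "real d / 2" and ?c = "2 * real d" and ?\<kappa> = "(1 / (2 * sqrt pi)) ^ d"
  let ?a = "\<lambda>N. real (num_closed_walks d N) / fact N"
  let ?P = "\<lambda>k n. \<Prod>j=1..k. real n + (?s + real j) / 2"
  have pos: "phi ?c ?s N > 0" for N using assms by (intro phi_pos) auto
  have "egf_expands ?c ?s ((fps_const (1 / (2 * sqrt pi)) * line_fps) ^ d) ?a"
    using assms by (rule walks_egf_expands)
  then have "(\<lambda>N. ?a N - phi_sum ?c ?s ((fps_const (1 / (2 * sqrt pi)) * line_fps) ^ d) m N)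
      \<in> O[evens](phi ?c (?s + real (Suc m)))"
    unfolding egf_expands_def by blast
  then obtain C where "\<forall>\<^sub>F N in evens.
      norm (?a N - phi_sum ?c ?s ((fps_const (1 / (2 * sqrt pi)) * line_fps) ^ d) m N) \<le> C * norm (phi ?c (?s + real (Suc m)) N)"
    by (rule landau_o.bigE)
  then have C: "norm (?a N - phi_sum ?c ?s ((fps_const (1 / (2 * sqrt pi)) * line_fps) ^ d) m N) \<le>
      C * norm (phi ?c (?s + real (Suc m)) N)" if "even N" for N
    using that unfolding eventually_principal by blast
  have coeff: "((fps_const (1 / (2 * sqrt pi)) * line_fps) ^ d) $ k = ?\<kappa> * (line_fps ^ d) $ k" for k
    by (simp only: power_mult_distrib fps_const_power fps_mult_left_const_nth)
  define D where "D n = 2 * ?\<kappa> * phi ?c ?s (2 * n)" for n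
  have D: "D n > 0" for n using pos by (simp add: D_def)
  have main: "norm (reduced_quotient d n - (\<Sum>k\<le>m. (line_fps ^ d) $ k * real d ^ k / ?P k n)) \<le>
      C / (2 * ?\<kappa>) * (real d ^ Suc m / ?P (Suc m) n)" for n
  proof -
    have "phi_sum ?c ?s ((fps_const (1 / (2 * sqrt pi)) * line_fps) ^ d) m (2 * n) / D n =
        (\<Sum>k\<le>m. (line_fps ^ d) $ k * (phi ?c (?s + real k) (2 * n) / phi ?c ?s (2 * n)))"
      unfolding phi_sum_def coeff sum_distrib_left sum_divide_distrib D_def
      by (intro sum.cong refl) simp
    also have "\<dots> = (\<Sum>k\<le>m. (line_fps ^ d) $ k * real d ^ k / ?P k n)"
      unfolding phi_ratio_double[OF assms] by simp
    finally have "reduced_quotient d n - (\<Sum>k\<le>m. (line_fps ^ d) $ k * real d ^ k / ?P k n) =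
        (?a (2 * n) - phi_sum ?c ?s ((fps_const (1 / (2 * sqrt pi)) * line_fps) ^ d) m (2 * n)) / D n"
      by (simp add: reduced_quotient_def D_def diff_divide_distrib)
    also have "norm \<dots> \<le> C * norm (phi ?c (?s + real (Suc m)) (2 * n)) / D n"
      using C[of "2 * n"] D[of n] by (simp add: divide_right_mono)
    also have "norm (phi ?c (?s + real (Suc m)) (2 * n)) = phi ?c (?s + real (Suc m)) (2 * n)"
      by (simp add: phi_nonneg)
    also have "C * phi ?c (?s + real (Suc m)) (2 * n) / D n =
        C / (2 * ?\<kappa>) * (phi ?c (?s + real (Suc m)) (2 * n) / phi ?c ?s (2 * n))"
      by (simp add: D_def)
    finally show ?thesis unfolding phi_ratio_double[OF assms] .
  qed
  show "(\<lambda>n. reduced_quotient d n - (\<Sum>k\<le>m. (line_fps ^ d) $ k * real d ^ k / ?P k n)) \<in> O(\<lambda>n. 1 / real n ^ Suc m)"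
  proof (rule bigoI[where c = "\<bar>C / (2 * ?\<kappa>)\<bar> * real d ^ Suc m"])
    show "\<forall>\<^sub>F n in sequentially. norm (reduced_quotient d n - (\<Sum>k\<le>m. (line_fps ^ d) $ k * real d ^ k / ?P k n)) \<le>
        \<bar>C / (2 * ?\<kappa>)\<bar> * real d ^ Suc m * norm (1 / real n ^ Suc m)"
      using eventually_ge_at_top[of 1]
    proof eventually_elim
      case (elim n)
      have "(\<Prod>j=1..Suc m. real n) \<le> ?P (Suc m) n" by (intro prod_mono) auto
      then have le: "real n ^ Suc m \<le> ?P (Suc m) n" by (simp only: prod_constant) simp
      have n: "0 < real n ^ Suc m" using elim by (intro zero_less_power) auto
      have "C / (2 * ?\<kappa>) * (real d ^ Suc m / ?P (Suc m) n) \<le> \<bar>C / (2 * ?\<kappa>)\<bar> * (real d ^ Suc m / real n ^ Suc m)"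
      proof (rule mult_mono)
        show "real d ^ Suc m / ?P (Suc m) n \<le> real d ^ Suc m / real n ^ Suc m"
          using le n by (intro frac_le zero_le_power of_nat_0_le_iff order_refl)
        show "0 \<le> real d ^ Suc m / ?P (Suc m) n"
          using less_le_trans[OF n le] by (intro divide_nonneg_pos zero_le_power of_nat_0_le_iff)
      qed (rule abs_ge_self abs_ge_zero)+
      with main[of n] have "norm (reduced_quotient d n - (\<Sum>k\<le>m. (line_fps ^ d) $ k * real d ^ k / ?P k n)) \<le>
          \<bar>C / (2 * ?\<kappa>)\<bar> * (real d ^ Suc m / real n ^ Suc m)" by (rule order_trans)
      also have "\<dots> = \<bar>C / (2 * ?\<kappa>)\<bar> * real d ^ Suc m * norm (1 / real n ^ Suc m)"
        using n by (simp del: power_Suc)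
      finally show ?case .
    qed
  qed
qed

lemma line_fps_power_nth:
  "(line_fps ^ d) $ 0 = 1" "(line_fps ^ d) $ 1 = real d / 16"
  "(line_fps ^ d) $ 2 = (8 * real d + real d ^ 2) / 512"
  "(line_fps ^ d) $ 3 = (200 * real d + 24 * real d ^ 2 + real d ^ 3) / 24576"
  "(line_fps ^ d) $ 4 = (9984 * real d + 992 * real d ^ 2 + 48 * real d ^ 3 + real d ^ 4) / 1572864"
proof (induction d)
  case 0
  { case 1 show ?case by simp }
  { case 2 show ?case by simp }
  { case 3 show ?case by simp }
  { case 4 show ?case by simp }
  { case 5 show ?case by simp }
next
  case (Suc d)
  have b: "line_fps $ 0 = 1" "line_fps $ 1 = 1 / 16" "line_fps $ 2 = 9 / 512"
    "line_fps $ 3 = 75 / 8192" "line_fps $ 4 = 3675 / 524288"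
    unfolding line_fps_def fps_nth_Abs_fps inv_sqrt_coeff_small pochhammer_half_small
    by simp_all
  note nth = power_Suc fps_mult_nth_small b Suc.IH
  { case 1 show ?case unfolding nth by simp }
  { case 2 show ?case unfolding nth by (simp add: field_simps) }
  { case 3 show ?case unfolding nth by (simp add: field_simps eval_nat_numeral) }
  { case 4 show ?case unfolding nth by (simp add: field_simps eval_nat_numeral) }
  { case 5 show ?case unfolding nth by (simp add: field_simps eval_nat_numeral) }
qed

text \<open>
  The first term of the factorial series is the claimed leading term times the Gamma quotient; the
  powers of \<open>2\<close>, \<open>\<pi>\<close>, \<open>d\<close> and \<open>n\<close> are collected as \<open>d\<close>-th powers of square roots.
\<close>

lemma walk_quotient_factor:
  assumes d: "d \<ge> 1" and n: "n \<ge> 1"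
  shows "walk_quotient d n = gamma_quotient (real d / 2) n * reduced_quotient d n"
proof -
  let ?s = "real d / 2" and ?A = "real (num_closed_walks d (2 * n))"
  have "real (2 * n) + 1 + ?s > 0" by (simp add: add_pos_nonneg)
  from Gamma_real_pos[OF this] have G: "Gamma (real (2 * n) + 1 + ?s) \<noteq> 0" by (metis less_irrefl)
  have f: "Gamma (real (2 * n) + 1) = fact (2 * n)"
    using Gamma_fact[of "2 * n", where 'a = real] by (simp add: add.commute)
  have pw: "(2 * real d) powr (real (2 * n) + ?s) = (2 * real d) ^ (2 * n) * (2 * real d) powr ?s"
    unfolding powr_add using d by (subst powr_realpow) auto
  have lead: "2 * (1 / (2 * sqrt pi)) ^ d * (2 * real d) powr ?s * (pi * real n) powr ?s = lead_const d * (2 * real n) powr ?s"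
  proof -
    have h: "x powr ?s = sqrt x ^ d" if "x > 0" for x
    proof -
      have "x powr ?s = (x powr (1 / 2)) powr real d" by (simp add: powr_powr)
      also have "\<dots> = sqrt x ^ d" using that by (simp add: powr_half_sqrt powr_realpow)
      finally show ?thesis .
    qed
    \<comment> \<open>The power \<open>d - 1\<close> in the leading constant absorbs the factor 2 of the series.\<close>
    have two: "(1 / 2) ^ d * 2 = 1 / (2::real) ^ (d - 1)"
      using d by (cases d) (auto simp: power_one_over)
    have "1 / (2 * sqrt pi) * sqrt (2 * real d) * sqrt (pi * real n) = 1 / 2 * sqrt (real d) * sqrt (2 * real n)"
      by (simp add: real_sqrt_mult)
    then have "(1 / (2 * sqrt pi) * sqrt (2 * real d) * sqrt (pi * real n)) ^ d = (1 / 2 * sqrt (real d) * sqrt (2 * real n)) ^ d"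
      by (rule arg_cong)
    then have "(1 / (2 * sqrt pi)) ^ d * sqrt (2 * real d) ^ d * sqrt (pi * real n) ^ d = (1 / 2) ^ d * sqrt (real d) ^ d * sqrt (2 * real n) ^ d"
      by (simp only: power_mult_distrib)
    then have "2 * (1 / (2 * sqrt pi)) ^ d * sqrt (2 * real d) ^ d * sqrt (pi * real n) ^ d = ((1 / 2) ^ d * 2) * sqrt (real d) ^ d * sqrt (2 * real n) ^ d"
      by (simp only: mult_ac)
    also have "\<dots> = lead_const d * sqrt (2 * real n) ^ d"
      unfolding two lead_const_def using h[of "real d"] d by simp
    finally show ?thesis using h[of "2 * real d"] h[of "pi * real n"] h[of "2 * real n"] d n by simp
  qed
  have nz: "(2 * real n) powr ?s \<noteq> 0" "(pi * real n) powr ?s \<noteq> 0" "(2 * real d) powr ?s \<noteq> 0"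
    "lead_const d \<noteq> 0" "(2 * real d) ^ (2 * n) \<noteq> 0" "(1 / (2 * sqrt pi)) ^ d \<noteq> 0"
    using d n by (auto simp: lead_const_def)
  have "gamma_quotient ?s n * reduced_quotient d n = ?A * (2 * real n) powr ?s /
      (2 * (1 / (2 * sqrt pi)) ^ d * (2 * real d) powr ?s * (2 * real d) ^ (2 * n))"
    unfolding gamma_quotient_def reduced_quotient_def phi_def f pw using G by (simp add: mult_ac)
  also have "2 * (1 / (2 * sqrt pi)) ^ d * (2 * real d) powr ?s = lead_const d * (2 * real n) powr ?s / (pi * real n) powr ?s"
    unfolding lead[symmetric] using nz by simp
  also have "?A * (2 * real n) powr ?s / (lead_const d * (2 * real n) powr ?s / (pi * real n) powr ?s * (2 * real d) ^ (2 * n)) =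
      walk_quotient d n"
    unfolding walk_quotient_def using nz by (simp add: mult_ac)
  finally show ?thesis by simp
qed

definition walk_series :: "nat \<Rightarrow> real fps \<Rightarrow> bool" where
  "walk_series d F \<longleftrightarrow> expands (walk_quotient d) F \<and> F $ 0 = 1 \<and> F $ 1 = - real d / 8 \<and>
    F $ 2 = (2 * real d ^ 3 - 3 * real d ^ 2 + 4 * real d) / 384 \<and>
    F $ 3 = 1 / 1024 * real d ^ 2 * (2 * real d ^ 2 - 9 * real d + 12) \<and>
    F $ 4 = 1 / 1474560 * real d * (20 * real d ^ 5 + 2484 * real d ^ 4 - 13105 * real d ^ 3
              + 21480 * real d ^ 2 - 11440 * real d - 384)"

definition ratio_series :: "nat \<Rightarrow> real fps \<Rightarrow> bool" where
  "ratio_series d R \<longleftrightarrow> expands (\<lambda>n. walk_quotient d n * (1 / central_quotient n)) R \<and> R $ 0 = 1 \<and>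
    R $ 1 = (1 - real d) / 8 \<and>
    R $ 2 = (real d ^ 2 - 1) * (2 * real d - 3) / 384 \<and>
    R $ 3 = 1 / 3072 * (real d - 1) * (6 * real d ^ 3 - 19 * real d ^ 2 + 14 * real d + 15) \<and>
    R $ 4 = 1 / 1474560 * (real d - 1) * (20 * real d ^ 5 + 2504 * real d ^ 4 - 10241 * real d ^ 3
              + 9679 * real d ^ 2 + 309 * real d + 945)"

text \<open>
  The coefficients are those of the product of the Gamma quotient series at \<open>s = d/2\<close> and of the
  factorial series, up to degree four.
\<close>

lemma walk_series_exists:
  assumes "d \<ge> 1"
  shows "\<exists>F. walk_series d F"
proof -
  obtain G where G: "gamma_quotient_series (real d / 2) G"
    using gamma_quotient_series_exists by blast
  let ?S = "factorial_series_fps (\<lambda>j. (real d / 2 + real j) / 2) (\<lambda>k. (line_fps ^ d) $ k * real d ^ k)"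
  have "expands (\<lambda>n. gamma_quotient (real d / 2) n * reduced_quotient d n) (G * ?S)"
    using G assms by (intro expands_mult reduced_quotient_expands) (auto simp: gamma_quotient_series_def)
  then have ex: "expands (walk_quotient d) (G * ?S)"
  proof (rule expands_cong)
    show "\<forall>\<^sub>F n in sequentially. gamma_quotient (real d / 2) n * reduced_quotient d n = walk_quotient d n"
      using eventually_ge_at_top[of 1] by eventually_elim (use walk_quotient_factor[OF assms] in simp)
  qed
  \<comment> \<open>Expressing everything through \<open>s\<close> leaves polynomial identities in one variable.\<close>
  define s where "s = real d / 2"
  have s: "real d = 2 * s" by (simp add: s_def)
  have G_nth: "G $ 0 = 1" "G $ 1 = - (s + s ^ 2) / 4"
     "G $ 2 = (2 * s + 9 * s ^ 2 + 10 * s ^ 3 + 3 * s ^ 4) / 96"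
     "G $ 3 = - (6 * s ^ 2 + 17 * s ^ 3 + 17 * s ^ 4 + 7 * s ^ 5 + s ^ 6) / 384"
     "G $ 4 = (- 48 * s + 20 * s ^ 2 + 900 * s ^ 3 + 2015 * s ^ 4 + 1848 * s ^ 5 + 830 * s ^ 6
       + 180 * s ^ 7 + 15 * s ^ 8) / 92160"
    using G by (auto simp: gamma_quotient_series_def s_def)
  show ?thesis
    unfolding walk_series_def
  proof (intro exI[of _ "G * ?S"] conjI ex)
    show "(G * ?S) $ 0 = 1"
      unfolding fps_mult_nth_small factorial_series_fps_nth line_fps_power_nth G_nth by simp
    show "(G * ?S) $ 1 = - real d / 8"
      unfolding fps_mult_nth_small factorial_series_fps_nth line_fps_power_nth G_nth s
      by (simp add: field_simps eval_nat_numeral)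
    show "(G * ?S) $ 2 = (2 * real d ^ 3 - 3 * real d ^ 2 + 4 * real d) / 384"
      unfolding fps_mult_nth_small factorial_series_fps_nth line_fps_power_nth G_nth s
      by (simp add: field_simps eval_nat_numeral)
    show "(G * ?S) $ 3 = 1 / 1024 * real d ^ 2 * (2 * real d ^ 2 - 9 * real d + 12)"
      unfolding fps_mult_nth_small factorial_series_fps_nth line_fps_power_nth G_nth s
      by (simp add: field_simps eval_nat_numeral)
    show "(G * ?S) $ 4 = 1 / 1474560 * real d * (20 * real d ^ 5 + 2484 * real d ^ 4 - 13105 * real d ^ 3
              + 21480 * real d ^ 2 - 11440 * real d - 384)"
      unfolding fps_mult_nth_small factorial_series_fps_nth line_fps_power_nth G_nth s
      by (simp add: field_simps eval_nat_numeral)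
  qed
qed

text \<open>
  Dividing by the central binomial coefficient, which is \<open>4\<^bsup>n\<^esup> / \<surd>(\<pi> n)\<close> times its own quotient,
  lowers the exponent of \<open>\<pi> n\<close> by \<open>1/2\<close> and the base from \<open>2d\<close> to \<open>d\<close>.
\<close>

lemma walk_ratio_quotient:
  assumes "d \<ge> 1" "n \<ge> 1"
  shows "walk_ratio d n = lead_const d * (real d ^ (2 * n) / (pi * real n) powr ((real d - 1) / 2)) *
    (walk_quotient d n * (1 / central_quotient n))"
proof -
  have pos: "pi * real n > 0" using assms by simp
  have "(pi * real n) powr (real d / 2) = (pi * real n) powr ((real d - 1) / 2 + 1 / 2)"
    by (simp add: diff_divide_distrib)
  also have "\<dots> = (pi * real n) powr ((real d - 1) / 2) * sqrt (pi * real n)"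
    using pos by (simp only: powr_add powr_half_sqrt less_imp_le)
  finally have p: "(pi * real n) powr (real d / 2) = (pi * real n) powr ((real d - 1) / 2) * sqrt (pi * real n)" .
  have nz: "(pi * real n) powr ((real d - 1) / 2) \<noteq> 0" "sqrt (pi * real n) \<noteq> 0" "lead_const d \<noteq> 0" "real d ^ (2 * n) \<noteq> 0"
    using assms by (auto simp: lead_const_def)
  have q: "(2 * real d) ^ (2 * n) = 4 ^ n * real d ^ (2 * n)"
    by (simp add: power_mult_distrib power_mult)
  show ?thesis
    unfolding walk_ratio_def walk_quotient_def central_quotient_choose[OF assms(2)] p q
    using nz by (simp add: mult_ac)
qed

text \<open>
  The error sequence is defined as the difference, so that the formula is exact for every
  \<open>n \<ge> 1\<close>.
\<close>

lemma expands_asymptotic_formula: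
  assumes f: "expands f F" and F: "F $ 0 = 1" and eq: "\<And>n. n \<ge> 1 \<Longrightarrow> u n = v n * f n"
  shows "\<exists>E. E \<in> O(\<lambda>n. 1 / real n ^ (m + 1)) \<and>
    (\<forall>n\<ge>1. u n = v n * (1 + (\<Sum>k = 1..m. F $ k / real n ^ k) + E n))"
proof (intro exI[of _ "\<lambda>n. f n - psum F m n"] conjI allI impI)
  show "(\<lambda>n. f n - psum F m n) \<in> O(\<lambda>n. 1 / real n ^ (m + 1))"
    using expands_bigo[OF f, of m] by simp
  fix n :: nat assume "n \<ge> 1"
  have "psum F m n = 1 + (\<Sum>k = 1..m. F $ k / real n ^ k)"
    unfolding psum_def atMost_atLeast0 by (subst sum.atLeast_Suc_atMost) (auto simp: F)
  with eq[OF \<open>n \<ge> 1\<close>] show "u n = v n * (1 + (\<Sum>k = 1..m. F $ k / real n ^ k) + (f n - psum F m n))"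
    by simp
qed

lemma ratio_series_exists:
  assumes "d \<ge> 1"
  shows "\<exists>R. ratio_series d R"
proof -
  obtain F where "walk_series d F" using walk_series_exists[OF assms] by blast
  then have F: "expands (walk_quotient d) F" "F $ 0 = 1" "F $ 1 = - real d / 8" "F $ 2 = (2 * real d ^ 3 - 3 * real d ^ 2 + 4 * real d) / 384" "F $ 3 = 1 / 1024 * real d ^ 2 * (2 * real d ^ 2 - 9 * real d + 12)" "F $ 4 = 1 / 1474560 * real d * (20 * real d ^ 5 + 2484 * real d ^ 4 - 13105 * real d ^ 3
              + 21480 * real d ^ 2 - 11440 * real d - 384)"
    by (auto simp: walk_series_def)
  obtain H where H: "expands central_quotient H" "H $ 0 = 1" "H $ 1 = - 1 / 8" "H $ 2 = 1 / 128"
    "H $ 3 = 5 / 1024" "H $ 4 = - 21 / 32768"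
    by (rule central_quotient_expands)
  have ex: "expands (\<lambda>n. walk_quotient d n * (1 / central_quotient n)) (F * inverse H)"
    using H(2) by (intro expands_mult expands_inverse F H) auto
  note nth = fps_mult_nth_small fps_inverse_nth_small[OF H(2)] F H
  show ?thesis
    unfolding ratio_series_def
    by (intro exI[of _ "F * inverse H"] conjI ex; unfold nth; simp add: field_simps eval_nat_numeral)
qed

lemma coefficient_polynomials:
  shows "\<exists>p. degree p = 4 \<and> (\<forall>x. 1 / 3072 * (x - 1) * (6 * x ^ 3 - 19 * x ^ 2 + 14 * x + 15) = poly p (x::real))"
    "\<exists>p. degree p = 6 \<and> (\<forall>x. 1 / 1474560 * (x - 1) * (20 * x ^ 5 + 2504 * x ^ 4 - 10241 * x ^ 3 + 9679 * x ^ 2 + 309 * x + 945) = poly p (x::real))"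
    "\<exists>p. degree p = 4 \<and> (\<forall>x. 1 / 1024 * x ^ 2 * (2 * x ^ 2 - 9 * x + 12) = poly p (x::real))"
    "\<exists>p. degree p = 6 \<and> (\<forall>x. 1 / 1474560 * x * (20 * x ^ 5 + 2484 * x ^ 4 - 13105 * x ^ 3 + 21480 * x ^ 2 - 11440 * x - 384) = poly p (x::real))"
proof -
  show "\<exists>p. degree p = 4 \<and> (\<forall>x. 1 / 3072 * (x - 1) * (6 * x ^ 3 - 19 * x ^ 2 + 14 * x + 15) = poly p (x::real))"
  proof (intro exI conjI allI)
    show "degree (smult (1 / 3072) [:-15, 1, 33, -25, 6:] :: real poly) = 4" by simp
    fix x :: real
    have "(x - 1) * (6 * x ^ 3 - 19 * x ^ 2 + 14 * x + 15) = poly [:-15, 1, 33, -25, 6:] x"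
      by (simp add: algebra_simps eval_nat_numeral)
    then show "1 / 3072 * (x - 1) * (6 * x ^ 3 - 19 * x ^ 2 + 14 * x + 15) = poly (smult (1 / 3072) [:-15, 1, 33, -25, 6:]) x"
      by (simp only: poly_smult mult.assoc)
  qed
  show "\<exists>p. degree p = 6 \<and> (\<forall>x. 1 / 1474560 * (x - 1) * (20 * x ^ 5 + 2504 * x ^ 4 - 10241 * x ^ 3 + 9679 * x ^ 2 + 309 * x + 945) = poly p (x::real))"
  proof (intro exI conjI allI)
    show "degree (smult (1 / 1474560) [:-945, 636, -9370, 19920, -12745, 2484, 20:] :: real poly) = 6" by simp
    fix x :: real
    have "(x - 1) * (20 * x ^ 5 + 2504 * x ^ 4 - 10241 * x ^ 3 + 9679 * x ^ 2 + 309 * x + 945) = poly [:-945, 636, -9370, 19920, -12745, 2484, 20:] x"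
      by (simp add: algebra_simps eval_nat_numeral)
    then show "1 / 1474560 * (x - 1) * (20 * x ^ 5 + 2504 * x ^ 4 - 10241 * x ^ 3 + 9679 * x ^ 2 + 309 * x + 945) = poly (smult (1 / 1474560) [:-945, 636, -9370, 19920, -12745, 2484, 20:]) x"
      by (simp only: poly_smult mult.assoc)
  qed
  show "\<exists>p. degree p = 4 \<and> (\<forall>x. 1 / 1024 * x ^ 2 * (2 * x ^ 2 - 9 * x + 12) = poly p (x::real))"
  proof (intro exI conjI allI)
    show "degree (smult (1 / 1024) [:0, 0, 12, -9, 2:] :: real poly) = 4" by simp
    fix x :: real
    have "x ^ 2 * (2 * x ^ 2 - 9 * x + 12) = poly [:0, 0, 12, -9, 2:] x"
      by (simp add: algebra_simps eval_nat_numeral)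
    then show "1 / 1024 * x ^ 2 * (2 * x ^ 2 - 9 * x + 12) = poly (smult (1 / 1024) [:0, 0, 12, -9, 2:]) x"
      by (simp only: poly_smult mult.assoc)
  qed
  show "\<exists>p. degree p = 6 \<and> (\<forall>x. 1 / 1474560 * x * (20 * x ^ 5 + 2484 * x ^ 4 - 13105 * x ^ 3 + 21480 * x ^ 2 - 11440 * x - 384) = poly p (x::real))"
  proof (intro exI conjI allI)
    show "degree (smult (1 / 1474560) [:0, -384, -11440, 21480, -13105, 2484, 20:] :: real poly) = 6" by simp
    fix x :: real
    have "x * (20 * x ^ 5 + 2484 * x ^ 4 - 13105 * x ^ 3 + 21480 * x ^ 2 - 11440 * x - 384) = poly [:0, -384, -11440, 21480, -13105, 2484, 20:] x"
      by (simp add: algebra_simps eval_nat_numeral)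
    then show "1 / 1474560 * x * (20 * x ^ 5 + 2484 * x ^ 4 - 13105 * x ^ 3 + 21480 * x ^ 2 - 11440 * x - 384) = poly (smult (1 / 1474560) [:0, -384, -11440, 21480, -13105, 2484, 20:]) x"
      by (simp only: poly_smult mult.assoc)
  qed
qed

theorem theorem2:
  shows
    "(\<exists>r :: nat \<Rightarrow> nat \<Rightarrow> real.
       (\<forall>d\<ge>1. \<forall>m. \<exists>E :: nat \<Rightarrow> real.
          E \<in> O(\<lambda>n. 1 / real n ^ (m + 1)) \<and>
          (\<forall>n\<ge>1. walk_ratio d n =
             lead_const d * (real d ^ (2 * n) / (pi * real n) powr ((real d - 1) / 2)) *
             (1 + (\<Sum>k = 1..m. r k d / real n ^ k) + E n))) \<and>
       (\<forall>d\<ge>1.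
          r 1 d = (1 - real d) / 8 \<and>
          r 2 d = (real d ^ 2 - 1) * (2 * real d - 3) / 384 \<and>
          r 3 d = 1 / 3072 * (real d - 1) *
            (6 * real d ^ 3 - 19 * real d ^ 2 + 14 * real d + 15) \<and>
          r 4 d = 1 / 1474560 * (real d - 1) *
            (20 * real d ^ 5 + 2504 * real d ^ 4 - 10241 * real d ^ 3
              + 9679 * real d ^ 2 + 309 * real d + 945)) \<and>
       (\<exists>p :: real poly. degree p = 4 \<and> (\<forall>d\<ge>1. r 3 d = poly p (real d))) \<and>
       (\<exists>p :: real poly. degree p = 6 \<and> (\<forall>d\<ge>1. r 4 d = poly p (real d))))
     \<and>
     (\<exists>a :: nat \<Rightarrow> nat \<Rightarrow> real.
       (\<forall>d\<ge>1. \<forall>m. \<exists>E :: nat \<Rightarrow> real.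
          E \<in> O(\<lambda>n. 1 / real n ^ (m + 1)) \<and>
          (\<forall>n\<ge>1. real (num_closed_walks d (2 * n)) =
             lead_const d * ((2 * real d) ^ (2 * n) / (pi * real n) powr (real d / 2)) *
             (1 + (\<Sum>k = 1..m. a k d / real n ^ k) + E n))) \<and>
       (\<forall>d\<ge>1.
          a 1 d = - real d / 8 \<and>
          a 2 d = (2 * real d ^ 3 - 3 * real d ^ 2 + 4 * real d) / 384 \<and>
          a 3 d = 1 / 1024 * real d ^ 2 * (2 * real d ^ 2 - 9 * real d + 12) \<and>
          a 4 d = 1 / 1474560 * real d *
            (20 * real d ^ 5 + 2484 * real d ^ 4 - 13105 * real d ^ 3
              + 21480 * real d ^ 2 - 11440 * real d - 384)) \<and>
       (\<exists>p :: real poly. degree p = 4 \<and> (\<forall>d\<ge>1. a 3 d = poly p (real d))) \<and>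
       (\<exists>p :: real poly. degree p = 6 \<and> (\<forall>d\<ge>1. a 4 d = poly p (real d))))"
proof -
  obtain R where R: "\<And>d. d \<ge> 1 \<Longrightarrow> ratio_series d (R d)"
    using ratio_series_exists by metis
  have R_asymp: "\<exists>E. E \<in> O(\<lambda>n. 1 / real n ^ (m + 1)) \<and> (\<forall>n\<ge>1. walk_ratio d n =
      lead_const d * (real d ^ (2 * n) / (pi * real n) powr ((real d - 1) / 2)) *
      (1 + (\<Sum>k = 1..m. R d $ k / real n ^ k) + E n))" if "d \<ge> 1" for d m
    using R[OF that, unfolded ratio_series_def] walk_ratio_quotient[OF that]
    by (intro expands_asymptotic_formula[where f = "\<lambda>n. walk_quotient d n * (1 / central_quotient n)"]) blast+
  have R_poly: "\<exists>p. degree p = 4 \<and> (\<forall>d\<ge>1. R d $ 3 = poly p (real d))"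
    "\<exists>p. degree p = 6 \<and> (\<forall>d\<ge>1. R d $ 4 = poly p (real d))"
    using coefficient_polynomials(1,2) R unfolding ratio_series_def by metis+
  obtain F where F: "\<And>d. d \<ge> 1 \<Longrightarrow> walk_series d (F d)"
    using walk_series_exists by metis
  have quotient: "real (num_closed_walks d (2 * n)) =
      lead_const d * ((2 * real d) ^ (2 * n) / (pi * real n) powr (real d / 2)) * walk_quotient d n"
    if "d \<ge> 1" "n \<ge> 1" for d n
    using that by (simp add: walk_quotient_def lead_const_def)
  have F_asymp: "\<exists>E. E \<in> O(\<lambda>n. 1 / real n ^ (m + 1)) \<and> (\<forall>n\<ge>1. real (num_closed_walks d (2 * n)) =
      lead_const d * ((2 * real d) ^ (2 * n) / (pi * real n) powr (real d / 2)) *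
      (1 + (\<Sum>k = 1..m. F d $ k / real n ^ k) + E n))" if "d \<ge> 1" for d m
    using F[OF that, unfolded walk_series_def] quotient[OF that]
    by (intro expands_asymptotic_formula[where f = "walk_quotient d"]) blast+
  have F_poly: "\<exists>p. degree p = 4 \<and> (\<forall>d\<ge>1. F d $ 3 = poly p (real d))"
    "\<exists>p. degree p = 6 \<and> (\<forall>d\<ge>1. F d $ 4 = poly p (real d))"
    using coefficient_polynomials(3,4) F unfolding walk_series_def by metis+
  show ?thesis
  proof (rule conjI, goal_cases)
    case 1
    show ?case
      by (rule exI[of _ "\<lambda>k d. R d $ k"], intro conjI R_poly) (use R_asymp R[unfolded ratio_series_def] in blast)+
  next
    case 2
    show ?case
      by (rule exI[of _ "\<lambda>k d. F d $ k"], intro conjI F_poly) (use F_asymp F[unfolded walk_series_def] in blast)+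
  qed
qed

end
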